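(* Let $n\ge1$. The map $$\Psi:\ \bigsqcup_{\lambda,\rho\in\mathbb S}\mathrm{SST}(\lambda/\rho,n)^2\longrightarrow\mathfrak F_{\mathrm{fin}}(\mathscr C_n',\mathbb N)\times\mathbb S,\qquad(P,Q)\mapsto(\mathbf c,\nu),$$ is a bijection, where, with $\boldsymbol\lambda=\boldsymbol\lambda[P,Q]$, $\mathbf c$ is the environment associated to $\boldsymbol\lambda$ and $\nu=(\nu_1,\dots,\nu_m)$ is given by $m=\max\{i:\lim_{t\to-\infty}\boldsymbol\lambda_i(t,0)\text{ exists and is finite}\}$ ($m=0$ and $\nu=\varnothing$ if there is no such $i$) and $\nu_i=\lim_{t\to-\infty}\boldsymbol\lambda_i(t,0)$ for $i=1,\dots,m$.
   Context: $\mathbb N=\{0,1,\dots\}$, $\mathbb Z'=\mathbb Z+\frac12$. A signature of length $\ell\ge0$ is a sequence of integers $\lambda=(\lambda_1\ge\dots\ge\lambda_\ell)$; $\mathbb S_\ell$ is the set of these, $\mathbb S=\bigsqcup_{\ell\ge0}\mathbb S_\ell$. Conjugate: $\lambda'_x=\#\{j:\lambda_j\ge x\}$, $x\in\mathbb Z$. $\kappa\preceq\mu$ (same length) means $\mu_1\ge\kappa_1\ge\mu_2\ge\kappa_2\ge\cdots$, equivalently $\mu'_x-\kappa'_x\in\{0,1\}$ for all $x$. For $\kappa\preceq\mu$, $\kappa\preceq\lambda$ in $\mathbb S_\ell$ put $a_x=\mu'_x-\kappa'_x$, $b_x=\lambda'_x-\kappa'_x$, and $c_x=\max\{0,a_x+b_x+c_{x-1}-1\}$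 with $c_x=0$ for $x$ sufficiently negative. $\overline{\mathsf F}(\kappa,\mu,\lambda)=\nu\in\mathbb S_\ell$ is given by $\nu'_x=\mu'_x+\lambda'_x-\kappa'_x+c_{x-1}-c_x$; the number $c_0$ (value at $x=0$) is the carrier load at the origin for $(\kappa,\mu,\lambda)$. $\mathscr C_n=\mathbb Z^2/\sim$ and $\mathscr C_n'=(\mathbb Z')^2/\sim$, where $(x,y)\sim(x+kn,y-kn)$, $k\in\mathbb Z$ ($\mathscr C'_n$ is the set of faces of $\mathscr C_n$). A Fomin field is a map $\boldsymbol\lambda:\mathscr C_n\to\mathbb S_\ell$ with $\boldsymbol\lambda(p)\preceq\boldsymbol\lambda(p+\mathbf e_i)$ ($i=1,2$) and $\boldsymbol\lambda(p+\mathbf e_1+\mathbf e_2)=\overline{\mathsf F}(\boldsymbol\lambda(p),\boldsymbol\lambda(p+\mathbf e_1),\boldsymbol\lambda(p+\mathbf e_2))$ for all $p$. Its environment is $\mathbf c:\mathscr C_n'\to\mathbb N$, where $\mathbf c(p+(\mathbf e_1+\mathbf e_2)/2)$ is the carrier load at the origin $c_0$ for $(\boldsymbol\lambda(p),\boldsymbol\lambda(p+\mathbf e_1),\boldsymbol\lambda(p+\mathbf e_2))$. $\mathfrak F_{\mathrm{fin}}(\mathscr C'_n,\mathbb N)$ is the set of finitely supported functions $\mathscr C_n'\to\mathbb N$. For $\rho,\lambda$ of the same length, $P\in\mathrm{SST}(\lambda/\rho,n)$ (semistandard tableau of skew shape) is a chain $\rho=\lambda^{(0)}\preceq\lambda^{(1)}\preceq\dots\preceq\lambda^{(n)}=\lambda$.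 For $P=(\lambda^{(i)})_i$, $Q=(\mu^{(i)})_i$ in $\mathrm{SST}(\lambda/\rho,n)$, $\boldsymbol\lambda[P,Q]$ is the unique Fomin field on $\mathscr C_n$ with $\boldsymbol\lambda(i,0)=\lambda^{(i)}$, $\boldsymbol\lambda(0,i)=\mu^{(i)}$, $0\le i\le n$. *)

theory Defs
  imports Complex_Main "HOL-Library.FuncSet"
begin

text \<open>A signature is an integer list, so \<open>\<lambda>\<^sub>j\<close> is \<open>\<lambda> ! (j - 1)\<close>.\<close>

definition signatures_of_length :: "nat \<Rightarrow> int list set" where
  "signatures_of_length l = {lam. length lam = l \<and> sorted_wrt (\<ge>) lam}"

definition signatures :: "int list set" where
  "signatures = (\<Union>l. signatures_of_length l)"

definition conjugate :: "int list \<Rightarrow> int \<Rightarrow> nat" where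
  "conjugate lam x = card {j. j < length lam \<and> lam ! j \<ge> x}"

definition interlaces :: "int list \<Rightarrow> int list \<Rightarrow> bool"  (infix "\<preceq>" 50) where
  "kap \<preceq> mu \<longleftrightarrow> length kap = length mu
     \<and> (\<forall>i < length mu. mu ! i \<ge> kap ! i)
     \<and> (\<forall>i. Suc i < length mu \<longrightarrow> kap ! i \<ge> mu ! Suc i)"

text \<open>For \<open>kap \<preceq> mu\<close> and \<open>kap \<preceq> lam\<close> the recursion below, started from \<open>0\<close> at
  \<open>x \<rightarrow> -\<infinity>\<close>, has exactly one solution; in other cases the value is irrelevant.\<close>

definition carrier_load :: "int list \<Rightarrow> int list \<Rightarrow> int list \<Rightarrow> int \<Rightarrow> nat" where
  "carrier_load kap mu lam = (THE c.
     (\<forall>\<^sub>F x in at_bot. c x = 0) \<and>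
     (\<forall>x. int (c x) = max 0
        ((int (conjugate mu x) - int (conjugate kap x))
         + (int (conjugate lam x) - int (conjugate kap x))
         + int (c (x - 1)) - 1)))"

definition fomin_rule :: "int list \<Rightarrow> int list \<Rightarrow> int list \<Rightarrow> int list" where
  "fomin_rule kap mu lam = (THE nu.
     nu \<in> signatures_of_length (length kap) \<and>
     (\<forall>x. int (conjugate nu x) =
        int (conjugate mu x) + int (conjugate lam x) - int (conjugate kap x)
        + int (carrier_load kap mu lam (x - 1)) - int (carrier_load kap mu lam x)))"

text \<open>The same relation is used on pairs of integers (vertices) and on pairs of half-integers,
  realised inside the rationals (faces).\<close>

definition cyl_rel :: "nat \<Rightarrow> (('a::ring_1 \<times> 'a) \<times> ('a \<times> 'a)) set" where
  "cyl_rel n = {((x, y), (x', y')).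
     \<exists>k::int. x' = x + of_int (k * int n) \<and> y' = y - of_int (k * int n)}"

definition half_integers :: "rat set" where
  "half_integers = {of_int i + 1/2 | i. True}"

definition cylinder :: "nat \<Rightarrow> (int \<times> int) set set" where
  "cylinder n = UNIV // cyl_rel n"

definition cylinder_faces :: "nat \<Rightarrow> (rat \<times> rat) set set" where
  "cylinder_faces n = (half_integers \<times> half_integers) // cyl_rel n"

definition vertex :: "nat \<Rightarrow> int \<Rightarrow> int \<Rightarrow> (int \<times> int) set" where
  "vertex n i j = cyl_rel n `` {(i, j)}"

text \<open>The face with lower left corner \<open>(i, j)\<close>.\<close>

definition face :: "nat \<Rightarrow> int \<Rightarrow> int \<Rightarrow> (rat \<times> rat) set" where
  "face n i j = cyl_rel n `` {(of_int i + 1/2, of_int j + 1/2)}"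

definition fomin_fields :: "nat \<Rightarrow> nat \<Rightarrow> ((int \<times> int) set \<Rightarrow> int list) set" where
  "fomin_fields n l = {L \<in> cylinder n \<rightarrow>\<^sub>E signatures_of_length l.
     \<forall>i j. L (vertex n i j) \<preceq> L (vertex n (i + 1) j)
         \<and> L (vertex n i j) \<preceq> L (vertex n i (j + 1))
         \<and> L (vertex n (i + 1) (j + 1)) =
             fomin_rule (L (vertex n i j)) (L (vertex n (i + 1) j)) (L (vertex n i (j + 1)))}"

text \<open>Functions on the set of faces are total functions vanishing off it.\<close>

definition finsupp_functions :: "'a set \<Rightarrow> ('a \<Rightarrow> nat) set" where
  "finsupp_functions A = {c. finite {x. c x \<noteq> 0} \<and> (\<forall>x. x \<notin> A \<longrightarrow> c x = 0)}"

definition environment ::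
    "nat \<Rightarrow> ((int \<times> int) set \<Rightarrow> int list) \<Rightarrow> (rat \<times> rat) set \<Rightarrow> nat" where
  "environment n L = (THE c.
     (\<forall>F. F \<notin> cylinder_faces n \<longrightarrow> c F = 0) \<and>
     (\<forall>i j. c (face n i j) =
        carrier_load (L (vertex n i j)) (L (vertex n (i + 1) j)) (L (vertex n i (j + 1))) 0))"

text \<open>A tableau is the list \<open>[\<lambda>\<^sup>0, \<dots>, \<lambda>\<^sup>n]\<close>. If \<open>lam\<close> and \<open>rho\<close> have different
  lengths there is none.\<close>

definition SST :: "int list \<Rightarrow> int list \<Rightarrow> nat \<Rightarrow> int list list set" where
  "SST lam rho n = {P. length P = n + 1 \<and> set P \<subseteq> signatures
     \<and> P ! 0 = rho \<and> P ! n = lam \<and> (\<forall>i < n. P ! i \<preceq> P ! Suc i)}"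

definition field_of_tableaux ::
    "nat \<Rightarrow> int list list \<Rightarrow> int list list \<Rightarrow> (int \<times> int) set \<Rightarrow> int list" where
  "field_of_tableaux n P Q = (THE L. L \<in> fomin_fields n (length (P ! 0)) \<and>
     (\<forall>i \<le> n. L (vertex n (int i) 0) = P ! i \<and> L (vertex n 0 (int i)) = Q ! i))"

text \<open>Limits are taken in the discrete space \<open>int\<close>, so an existing limit is automatically
  finite. The first argument \<open>l\<close> is the length of the signatures in the sequence \<open>s\<close>.\<close>

definition limit_length :: "nat \<Rightarrow> (int \<Rightarrow> int list) \<Rightarrow> nat" where
  "limit_length l s =
     (let I = {i \<in> {1..l}. \<exists>a. ((\<lambda>t. s t ! (i - 1)) \<longlongrightarrow> a) at_bot}
      in if I = {} then 0 else Max I)"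

definition limit_signature :: "nat \<Rightarrow> (int \<Rightarrow> int list) \<Rightarrow> int list" where
  "limit_signature l s =
     map (\<lambda>i. Lim at_bot (\<lambda>t. s t ! (i - 1))) [1..<Suc (limit_length l s)]"

text \<open>The first component of the argument records the shape \<open>(lam, rho)\<close>.\<close>

definition Psi :: "nat \<Rightarrow> (int list \<times> int list) \<times> (int list list \<times> int list list)
    \<Rightarrow> ((rat \<times> rat) set \<Rightarrow> nat) \<times> int list" where
  "Psi n = (\<lambda>((lam, rho), (P, Q)).
     let L = field_of_tableaux n P Q
     in (environment n L, limit_signature (length rho) (\<lambda>t. L (vertex n t 0))))"

end

theory Submission imports Defs begin

text \<open>For fixed \<open>x\<close>, the heights \<open>p \<mapsto> \<lambda>'\<^sub>x(p)\<close> of a Fomin field obey a last passage recursion on the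
  cylinder whose source is the field of carrier loads \<open>c\<^sub>x\<^sub>-\<^sub>1\<close>; the loads \<open>c\<^sub>x\<close> are its output. The
  heights are bounded and monotone, hence constant in the far past, where the value is \<open>\<nu>'\<^sub>x\<close>, and in the
  far future. So the loads are finitely supported, and \<open>c\<^sub>x\<^sub>-\<^sub>1\<close> and \<open>\<nu>'\<^sub>x\<close> determine the column and
  \<open>c\<^sub>x\<close>. The local rule is invariant under time reversal, which exchanges \<open>c\<^sub>x\<^sub>-\<^sub>1\<close> with \<open>c\<^sub>x\<close>; thus
  \<open>c\<^sub>x\<^sub>-\<^sub>1 \<mapsto> c\<^sub>x\<close> is a bijection of the finitely supported functions, and \<open>c\<^sub>0\<close> together with \<open>\<nu>\<close>
  determines all columns.

  Conversely, start the columns from any \<open>c\<^sub>0\<close>. The height gained in column \<open>x\<close> decreases with \<open>x\<close> at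
  every vertex, its total over time does not depend on \<open>x\<close> (again by reversal), and at a given vertex it
  is \<open>0\<close> for large \<open>x\<close> and equal to the total for very negative \<open>x\<close>. Adding \<open>\<nu>'\<^sub>x\<close> therefore gives
  the conjugates of signatures of one common length.\<close>

section \<open>Dynamics of a single column\<close>

text \<open>In the column \<open>x\<close>, the numbers \<open>k, m, l, v\<close> are the values at \<open>x\<close> of the conjugates
  of \<open>\<kappa>, \<mu>, \<lambda>, \<nu>\<close>, and \<open>c, d\<close> are the carrier loads \<open>c\<^sub>x\<^sub>-\<^sub>1, c\<^sub>x\<close>. Writing the rule
  with maxima exhibits it as last passage percolation and makes its time reversal
  \<open>box_flip\<close> apparent.\<close>

definition box :: "int \<Rightarrow> int \<Rightarrow> int \<Rightarrow> int \<Rightarrow> nat \<Rightarrow> nat \<Rightarrow> bool" where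
  "box k m l v c d \<longleftrightarrow> k \<le> m \<and> m \<le> k + 1 \<and> k \<le> l \<and> l \<le> k + 1
     \<and> v = max (max m l) (if c > 0 then k + 1 else k)
     \<and> int d = int c + m + l - k - v"

definition column :: "(int \<Rightarrow> int \<Rightarrow> int) \<Rightarrow> (int \<Rightarrow> int \<Rightarrow> nat) \<Rightarrow> (int \<Rightarrow> int \<Rightarrow> nat) \<Rightarrow> bool" where
  "column h c d \<longleftrightarrow>
     (\<forall>i j. box (h i j) (h (i + 1) j) (h i (j + 1)) (h (i + 1) (j + 1)) (c i j) (d i j))"

text \<open>Functions on the vertices or faces of the cylinder are functions on the plane with the
  following periodicity; a face is indexed by its lower left corner.\<close>

definition periodic :: "nat \<Rightarrow> (int \<Rightarrow> int \<Rightarrow> 'a) \<Rightarrow> bool" where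
  "periodic n f \<longleftrightarrow> (\<forall>i j. f (i + int n) (j - int n) = f i j)"

text \<open>The level \<open>i + j\<close> is invariant under the identification of the cylinder and
  serves as time; \<open>a\<close> and \<open>b\<close> are the values in the far past and the far
  future.\<close>

definition transit :: "(int \<Rightarrow> int \<Rightarrow> int) \<Rightarrow> int \<Rightarrow> int \<Rightarrow> bool" where
  "transit h a b \<longleftrightarrow> (\<exists>B. \<forall>i j. (i + j \<le> - B \<longrightarrow> h i j = a) \<and> (B \<le> i + j \<longrightarrow> h i j = b))"

text \<open>For a load on the cylinder this amounts to finite support, because a level contains only
  \<open>n\<close> faces (\<open>finsupp_functions_iff\<close>).\<close>

definition level_bounded :: "(int \<Rightarrow> int \<Rightarrow> nat) \<Rightarrow> bool" where
  "level_bounded c \<longleftrightarrow> (\<exists>B. \<forall>i j. c i j \<noteq> 0 \<longrightarrow> \<bar>i + j\<bar> \<le> B)"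

definition flip :: "(int \<Rightarrow> int \<Rightarrow> int) \<Rightarrow> int \<Rightarrow> int \<Rightarrow> int" where
  "flip h i j = - h (- i) (- j)"

text \<open>Point reflection sends the lower left corner of a face to the upper right one, which
  shifts the index of the image by \<open>1\<close> in both coordinates.\<close>

definition flip_load :: "(int \<Rightarrow> int \<Rightarrow> nat) \<Rightarrow> int \<Rightarrow> int \<Rightarrow> nat" where
  "flip_load c i j = c (- i - 1) (- j - 1)"

text \<open>Solved for the past, the rule reads
  \<open>k = min (min m l) (if d > 0 then v - 1 else v)\<close>, with \<open>c\<close> given by the
  same balance. Negating the heights turns the minimum back into a maximum.\<close>

lemma box_flip: "box k m l v c d \<Longrightarrow> box (- v) (- l) (- m) (- k) d c"
  by (auto simp: box_def max_def split: if_splits)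

lemma box_add: "box (k + a) (m + a) (l + a) (v + a) c d \<longleftrightarrow> box k m l v c d"
  by (auto simp: box_def max_def split: if_splits)

lemma box_const: "box k k k k c d \<longleftrightarrow> c = 0 \<and> d = 0"
  by (auto simp: box_def)

lemma columnD:
  "column h c d \<Longrightarrow> box (h i j) (h (i + 1) j) (h i (j + 1)) (h (i + 1) (j + 1)) (c i j) (d i j)"
  by (simp add: column_def)

lemma columnD':
  "column h c d \<Longrightarrow>
     box (h (i - 1) (j - 1)) (h i (j - 1)) (h (i - 1) j) (h i j) (c (i - 1) (j - 1)) (d (i - 1) (j - 1))"
  using columnD[of h c d "i - 1" "j - 1"] by simp

lemma column_flip:
  assumes "column h c d"
  shows "column (flip h) (flip_load d) (flip_load c)"
  unfolding column_def flip_def flip_load_def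
proof (intro allI)
  fix i j :: int
  show "box (- h (- i) (- j)) (- h (- (i + 1)) (- j)) (- h (- i) (- (j + 1)))
          (- h (- (i + 1)) (- (j + 1))) (d (- i - 1) (- j - 1)) (c (- i - 1) (- j - 1))"
    using box_flip[OF columnD[OF assms, of "- i - 1" "- j - 1"]] by simp
qed

lemma flip_flip [simp]: "flip (flip h) = h" "flip_load (flip_load c) = c"
  by (auto simp: flip_def flip_load_def fun_eq_iff)

lemma column_add: "column (\<lambda>i j. h i j + a) c d \<longleftrightarrow> column h c d"
  by (simp add: column_def box_add)

lemma transit_flip: "transit h a b \<Longrightarrow> transit (flip h) (- b) (- a)"
  unfolding transit_def flip_def
proof (elim exE)
  fix B assume B: "\<forall>i j. (i + j \<le> - B \<longrightarrow> h i j = a) \<and> (B \<le> i + j \<longrightarrow> h i j = b)"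
  have "(i + j \<le> - B \<longrightarrow> - h (- i) (- j) = - b) \<and> (B \<le> i + j \<longrightarrow> - h (- i) (- j) = - a)" for i j
    using spec[OF spec[OF B, of "- i"], of "- j"] by auto
  then show "\<exists>B. \<forall>i j. (i + j \<le> - B \<longrightarrow> - h (- i) (- j) = - b) \<and> (B \<le> i + j \<longrightarrow> - h (- i) (- j) = - a)"
    by blast
qed

lemma transit_add: "transit h a b \<Longrightarrow> transit (\<lambda>i j. h i j + e) (a + e) (b + e)"
  unfolding transit_def by auto

lemma periodic_flip: "periodic n h \<Longrightarrow> periodic n (flip h)"
  unfolding periodic_def flip_def
proof (intro allI)
  fix i j assume "\<forall>i j. h (i + int n) (j - int n) = h i j"
  from spec[OF spec[OF this, of "- i - int n"], of "- j + int n"]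
  show "- h (- (i + int n)) (- (j - int n)) = - h (- i) (- j)" by (simp add: algebra_simps)
qed

lemma periodic_flip_load: "periodic n c \<Longrightarrow> periodic n (flip_load c)"
  unfolding periodic_def flip_load_def
proof (intro allI)
  fix i j assume "\<forall>i j. c (i + int n) (j - int n) = c i j"
  from spec[OF spec[OF this, of "- i - 1 - int n"], of "- j - 1 + int n"]
  moreover have "- (i + int n) - 1 = - i - 1 - int n" "- (j - int n) - 1 = - j - 1 + int n" by simp_all
  ultimately show "c (- (i + int n) - 1) (- (j - int n) - 1) = c (- i - 1) (- j - 1)" by (simp only:) simp
qed

lemma level_bounded_flip: "level_bounded c \<Longrightarrow> level_bounded (flip_load c)"
  unfolding level_bounded_def flip_load_def
proof (elim exE)
  fix B assume B: "\<forall>i j. c i j \<noteq> 0 \<longrightarrow> \<bar>i + j\<bar> \<le> B"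
  have "c (- i - 1) (- j - 1) \<noteq> 0 \<longrightarrow> \<bar>i + j\<bar> \<le> B + 2" for i j
    using spec[OF spec[OF B, of "- i - 1"], of "- j - 1"] by auto
  then show "\<exists>B. \<forall>i j. c (- i - 1) (- j - 1) \<noteq> 0 \<longrightarrow> \<bar>i + j\<bar> \<le> B" by blast
qed

section \<open>Induction over levels and uniqueness of columns\<close>

lemma periodic_mult:
  assumes "periodic n f"
  shows "f (i + k * int n) (j - k * int n) = f i j"
proof (induction k rule: int_induct[where k = 0])
  case base show ?case by simp
next
  case (step1 k)
  have "f (i + k * int n + int n) (j - k * int n - int n) = f (i + k * int n) (j - k * int n)"
    using assms unfolding periodic_def by blast
  then show ?case using step1 by (simp add: algebra_simps)
next
  case (step2 k)
  have "f (i + (k - 1) * int n + int n) (j - (k - 1) * int n - int n)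
      = f (i + (k - 1) * int n) (j - (k - 1) * int n)"
    using assms unfolding periodic_def by blast
  then show ?case using step2 by (simp add: algebra_simps)
qed

text \<open>Induction in time from a half plane on which \<open>R\<close> is known. The other
  corners of a box lie on lower levels than its upper right corner, so this fits the recursion of a
  column.\<close>

lemma level_induct [case_names base step]:
  fixes A :: int
  assumes base: "\<And>i j. i + j \<le> A \<Longrightarrow> R i j"
    and step: "\<And>i j. A < i + j \<Longrightarrow> (\<And>i' j'. i' + j' < i + j \<Longrightarrow> R i' j') \<Longrightarrow> R i j"
  shows "R i j"
proof -
  have "\<forall>i j. i + j \<le> A + int k \<longrightarrow> R i j" for k
  proof (induction k)
    case 0 show ?case using base by simp
  next
    case (Suc k)
    have "R i j" if ij: "i + j \<le> A + int (Suc k)" for i j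
    proof (cases "i + j \<le> A + int k")
      case True then show ?thesis using Suc by blast
    next
      case False
      with ij have "i + j = A + int (Suc k)" by simp
      then show ?thesis using step[of i j] Suc by simp
    qed
    then show ?case by blast
  qed
  from this[of "nat (i + j - A)"] show ?thesis by (cases "i + j \<le> A") (auto simp: base)
qed

text \<open>The rule computes \<open>v\<close> from \<open>k\<close>, \<open>m\<close>,
  \<open>l\<close> and \<open>c\<close>, so a common source propagates agreement out of the half
  plane \<open>i + j \<le> A\<close>; the outputs follow from the balance in
  \<open>box\<close>.\<close>

lemma column_unique:
  assumes h: "column h c d" and h': "column h' c d'"
    and past: "\<And>i j. i + j \<le> A \<Longrightarrow> h i j = h' i j"
  shows "h = h'" "d = d'"
proof -
  have eq: "h i j = h' i j" for i j
  proof (induction i j rule: level_induct[of A])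
    case base then show ?case using past by simp
  next
    case (step i j)
    show ?case using columnD'[OF h, of i j] columnD'[OF h', of i j] step(2)[of "i-1" "j-1"] step(2)[of "i-1" j] step(2)[of i "j-1"]
      by (auto simp: box_def)
  qed
  then show "h = h'" by (auto simp: fun_eq_iff)
  show "d = d'"
  proof (intro ext)
    fix i j
    show "d i j = d' i j" using columnD[OF h, of i j] columnD[OF h', of i j] by (auto simp: box_def eq)
  qed
qed

lemma column_unique_transit:
  assumes "column h c d" "column h' c d'" "transit h a b" "transit h' a b'"
  shows "h = h'" "d = d'"
proof -
  from assms(3,4) obtain B B' where
    "\<And>i j. i + j \<le> - B \<Longrightarrow> h i j = a" "\<And>i j. i + j \<le> - B' \<Longrightarrow> h' i j = a"
    unfolding transit_def by blast
  then have "i + j \<le> min (- B) (- B') \<Longrightarrow> h i j = h' i j" for i j by simp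
  from column_unique[OF assms(1,2) this] show "h = h'" "d = d'" by blast+
qed

lemma transit_past_unique: "transit h a b \<Longrightarrow> transit h a' b' \<Longrightarrow> a = a'"
proof -
  assume "transit h a b" "transit h a' b'"
  then obtain B B' where *:
    "\<And>i j. i + j \<le> - B \<Longrightarrow> h i j = a" "\<And>i j. i + j \<le> - B' \<Longrightarrow> h i j = a'"
    unfolding transit_def by blast
  show ?thesis using *(1)[of "min (- B) (- B')" 0] *(2)[of "min (- B) (- B')" 0] by simp
qed

text \<open>After time reversal the shared load \<open>d\<close> is the source. The future values
  \<open>b\<close> and \<open>b'\<close> are not assumed equal, so the heights are first compared up
  to a constant; the common past value \<open>a\<close> shows that it is zero.\<close>

lemma column_unique_transit_back:
  assumes "column h c d" "column h' c' d" "transit h a b" "transit h' a b'"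
  shows "h = h'" "c = c'"
proof -
  let ?g = "\<lambda>i j. flip h i j + b" and ?g' = "\<lambda>i j. flip h' i j + b'"
  have g: "column ?g (flip_load d) (flip_load c)" "column ?g' (flip_load d) (flip_load c')"
    using column_flip assms(1,2) column_add by blast+
  have t: "transit ?g 0 (b - a)" "transit ?g' 0 (b' - a)"
    using transit_add[OF transit_flip[OF assms(3)], of b] transit_add[OF transit_flip[OF assms(4)], of b']
    by simp_all
  note u = column_unique_transit[OF g t]
  have "flip_load (flip_load c) = flip_load (flip_load c')" using u(2) by (simp only:)
  then show "c = c'" by simp
  have "h' i j = h i j + (b' - b)" for i j
    using fun_cong[OF fun_cong[OF u(1), of "-i"], of "-j"] by (simp add: flip_def)
  then have h': "h' = (\<lambda>i j. h i j + (b' - b))" by (simp add: fun_eq_iff)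
  have "transit h' (a + (b' - b)) (b + (b' - b))" unfolding h' by (rule transit_add[OF assms(3)])
  from transit_past_unique[OF this assms(4)] show "h = h'" unfolding h' by simp
qed

section \<open>Monotone heights and their constant ends\<close>

lemma column_mono:
  assumes "column h c d" "i \<le> i'" "j \<le> j'"
  shows "h i j \<le> h i' j'"
proof -
  have 1: "h i j \<le> h (i + int k) j" for i j k
  proof (induction k)
    case (Suc k)
    then show ?case using columnD[OF assms(1), of "i + int k" j] by (auto simp: box_def algebra_simps)
  qed simp
  have 2: "h i j \<le> h i (j + int k)" for i j k
  proof (induction k)
    case (Suc k)
    then show ?case using columnD[OF assms(1), of i "j + int k"] by (auto simp: box_def algebra_simps)
  qed simp
  show ?thesis using 1[of i j "nat (i' - i)"] 2[of i' j "nat (j' - j)"] assms(2,3) by simp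
qed

text \<open>The translate of \<open>(i, j)\<close> whose first coordinate is one of the last
  \<open>n\<close> integers up to \<open>i'\<close> has second coordinate at most \<open>j'\<close>,
  by the gap \<open>n\<close> between the levels.\<close>

lemma periodic_mono_level:
  fixes h :: "int \<Rightarrow> int \<Rightarrow> int"
  assumes n: "n \<ge> 1" and per: "periodic n h"
    and mono: "\<And>i j i' j'. i \<le> i' \<Longrightarrow> j \<le> j' \<Longrightarrow> h i j \<le> h i' j'"
    and le: "i + j + int n \<le> i' + j'"
  shows "h i j \<le> h i' j'"
proof -
  define k where "k = (i' - i) div int n"
  have "k * int n + (i' - i) mod int n = i' - i" unfolding k_def by simp
  moreover have "0 \<le> (i' - i) mod int n" "(i' - i) mod int n < int n" using n by simp_all
  ultimately have "i + k * int n \<le> i'" "i' - int n < i + k * int n" by linarith+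
  then have "h (i + k * int n) (j - k * int n) \<le> h i' j'" using le by (intro mono) linarith+
  then show ?thesis using periodic_mult[OF per] by simp
qed

text \<open>A bounded integer function attains its extrema. From \<open>n\<close> levels below a
  minimiser on downwards no value exceeds the minimum; the maximum is symmetric.\<close>

lemma transit_of_bounded:
  fixes h :: "int \<Rightarrow> int \<Rightarrow> int"
  assumes "n \<ge> 1" "periodic n h"
    "\<And>i j i' j'. i \<le> i' \<Longrightarrow> j \<le> j' \<Longrightarrow> h i j \<le> h i' j'"
    and bd: "\<And>i j. m \<le> h i j" "\<And>i j. h i j \<le> M"
  shows "\<exists>a b. transit h a b"
proof -
  note pm = periodic_mono_level[OF assms(1-3)]
  let ?R = "range (\<lambda>(i, j). h i j)"
  have "?R \<subseteq> {m..M}" using bd by auto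
  then have fin: "finite ?R" using finite_subset by blast
  have ne: "?R \<noteq> {}" by simp
  obtain i0 j0 where 0: "h i0 j0 = Min ?R" using Min_in[OF fin ne] by auto
  obtain i1 j1 where 1: "h i1 j1 = Max ?R" using Max_in[OF fin ne] by auto
  have r: "Min ?R \<le> h i j" "h i j \<le> Max ?R" for i j
    using Min_le[OF fin, of "h i j"] Max_ge[OF fin, of "h i j"] by auto
  let ?B = "\<bar>i0 + j0\<bar> + \<bar>i1 + j1\<bar> + int n"
  have "(i + j \<le> - ?B \<longrightarrow> h i j = Min ?R) \<and> (?B \<le> i + j \<longrightarrow> h i j = Max ?R)" for i j
    using pm[of i j i0 j0] pm[of i1 j1 i j] r[of i j] 0 1 by (intro conjI impI antisym; linarith)
  then show ?thesis unfolding transit_def by blast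
qed

lemma column_level_bounded:
  assumes col: "column h c d" and tr: "transit h a b"
  shows "level_bounded c" "level_bounded d"
proof -
  obtain B where B: "\<And>i j. i + j \<le> - B \<Longrightarrow> h i j = a" "\<And>i j. B \<le> i + j \<Longrightarrow> h i j = b"
    using tr unfolding transit_def by blast
  \<comment> \<open>A box reaches from level \<open>i + j\<close> to \<open>i + j + 2\<close>; the
    margin \<open>2\<close> keeps all four corners in one constant region, where
    \<open>box_const\<close> applies.\<close>
  have *: "c i j = 0 \<and> d i j = 0" if "B + 2 < \<bar>i + j\<bar>" for i j
  proof (cases "0 < i + j")
    case True
    then have "h i j = b" "h (i + 1) j = b" "h i (j + 1) = b" "h (i + 1) (j + 1) = b"
      using that by (auto intro!: B(2))
    then show ?thesis using columnD[OF col, of i j] by (simp add: box_const)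
  next
    case False
    then have "h i j = a" "h (i + 1) j = a" "h i (j + 1) = a" "h (i + 1) (j + 1) = a"
      using that by (auto intro!: B(1))
    then show ?thesis using columnD[OF col, of i j] by (simp add: box_const)
  qed
  have "\<forall>i j. c i j \<noteq> 0 \<longrightarrow> \<bar>i + j\<bar> \<le> B + 2" "\<forall>i j. d i j \<noteq> 0 \<longrightarrow> \<bar>i + j\<bar> \<le> B + 2"
    by (intro allI impI; rule ccontr; use * in force)+
  then show "level_bounded c" "level_bounded d" unfolding level_bounded_def by blast+
qed

section \<open>Existence of columns\<close>

text \<open>Strict last passage percolation along the levels \<open>i + j = A + k\<close>.\<close>

fun passage :: "(int \<Rightarrow> int \<Rightarrow> nat) \<Rightarrow> int \<Rightarrow> nat \<Rightarrow> int \<Rightarrow> int" where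
  "passage c A 0 i = 0"
| "passage c A (Suc 0) i = 0"
| "passage c A (Suc (Suc k)) i =
     max (max (passage c A (Suc k) i) (passage c A (Suc k) (i - 1)))
       (if c (i - 1) (A + int k - (i - 1)) > 0 then passage c A k (i - 1) + 1 else passage c A k (i - 1))"

lemma passage_step:
  "passage c A k i \<le> passage c A (Suc k) i \<and> passage c A (Suc k) i \<le> passage c A k i + 1
   \<and> passage c A k i \<le> passage c A (Suc k) (i + 1) \<and> passage c A (Suc k) (i + 1) \<le> passage c A k i + 1"
proof (induction k arbitrary: i)
  case 0 show ?case by simp
next
  case (Suc k)
  show ?case using Suc[of i] Suc[of "i - 1"] Suc[of "i + 1"] by auto
qed

text \<open>The heights start from \<open>0\<close> before the first source and grow by the rule.
  After the last source the rule only takes maxima of earlier heights, so they stay bounded, and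
  boundedness gives the constant ends.\<close>

lemma column_exists:
  assumes n: "n \<ge> 1" and per: "periodic n c" and lb: "level_bounded c"
  shows "\<exists>h d H. column h c d \<and> transit h 0 H \<and> periodic n h \<and> periodic n d \<and> level_bounded d"
proof -
  obtain B where B: "\<And>i j. c i j \<noteq> 0 \<Longrightarrow> \<bar>i + j\<bar> \<le> B" using lb unfolding level_bounded_def by blast
  define A where "A = - B"
  have c0: "c i j = 0" if "i + j < A \<or> B < i + j" for i j
    using B[of i j] that unfolding A_def by linarith
  \<comment> \<open>\<open>passage c A k i\<close> is the height at \<open>(i, A + k - i)\<close>;
    \<open>nat\<close> extends the initial value \<open>0\<close> to all levels below
    \<open>A\<close>.\<close>
  define h where "h i j = passage c A (nat (i + j - A)) i" for i j
  define d where "d i j = nat (int (c i j) + h (i + 1) j + h i (j + 1) - h i j - h (i + 1) (j + 1))" for i j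
  have past: "h i j = 0" if "i + j \<le> A + 1" for i j
  proof -
    have "nat (i + j - A) = 0 \<or> nat (i + j - A) = Suc 0" using that by arith
    then show ?thesis unfolding h_def by auto
  qed
  have col: "column h c d"
    unfolding column_def
  proof (intro allI)
    fix i j
    show "box (h i j) (h (i + 1) j) (h i (j + 1)) (h (i + 1) (j + 1)) (c i j) (d i j)"
    proof (cases "i + j < A")
      case True
      then have "h i j = 0" "h (i + 1) j = 0" "h i (j + 1) = 0" "h (i + 1) (j + 1) = 0" "c i j = 0"
        by (auto intro!: past c0)
      then show ?thesis unfolding d_def by (simp add: box_const)
    next
      case False
      define k where "k = nat (i + j - A)"
      have k: "nat (i + j - A) = k" "nat (i + 1 + j - A) = Suc k" "nat (i + (j + 1) - A) = Suc k"
        "nat (i + 1 + (j + 1) - A) = Suc (Suc k)" "A + int k - i = j" using False unfolding k_def by auto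
      have hk: "h i j = passage c A k i" "h (i + 1) j = passage c A (Suc k) (i + 1)"
        "h i (j + 1) = passage c A (Suc k) i" "h (i + 1) (j + 1) = passage c A (Suc (Suc k)) (i + 1)"
        unfolding h_def by (simp_all only: k)
      have v: "h (i + 1) (j + 1) = max (max (h (i + 1) j) (h i (j + 1))) (if c i j > 0 then h i j + 1 else h i j)"
        unfolding hk using k(5) by simp
      have s: "h i j \<le> h (i + 1) j" "h (i + 1) j \<le> h i j + 1" "h i j \<le> h i (j + 1)" "h i (j + 1) \<le> h i j + 1"
        unfolding hk using passage_step[of c A k i] by auto
      show ?thesis unfolding box_def
      proof (intro conjI)
        show "int (d i j) = int (c i j) + h (i + 1) j + h i (j + 1) - h i j - h (i + 1) (j + 1)"
          unfolding d_def using v s by (auto simp: max_def split: if_splits)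
      qed (use v s in auto)
    qed
  qed
  \<comment> \<open>The translated column has the same source and the same past, so uniqueness
    identifies it with \<open>h\<close>.\<close>
  have ph: "periodic n h"
  proof -
    let ?g = "\<lambda>i j. h (i + int n) (j - int n)" and ?e = "\<lambda>i j. d (i + int n) (j - int n)"
    have "column ?g c ?e"
      unfolding column_def
    proof (intro allI)
      fix i j
      show "box (?g i j) (?g (i + 1) j) (?g i (j + 1)) (?g (i + 1) (j + 1)) (c i j) (?e i j)"
        using columnD[OF col, of "i + int n" "j - int n"] per
        by (simp add: periodic_def algebra_simps)
    qed
    from column_unique(1)[OF this col, of "A + 1"] have "?g = h" using past by simp
    then show ?thesis unfolding periodic_def by metis
  qed
  have pd: "periodic n d"
    unfolding periodic_def d_def
  proof (intro allI)
    fix i j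
    have "h (i + int n + 1) (j - int n) = h (i + 1) j" "h (i + int n) (j - int n + 1) = h i (j + 1)"
      "h (i + int n + 1) (j - int n + 1) = h (i + 1) (j + 1)"
      using ph[unfolded periodic_def, rule_format, of "i + 1" j] ph[unfolded periodic_def, rule_format, of i "j + 1"]
       ph[unfolded periodic_def, rule_format, of "i + 1" "j + 1"] by (simp_all add: algebra_simps)
    then show "nat (int (c (i + int n) (j - int n)) + h (i + int n + 1) (j - int n) + h (i + int n) (j - int n + 1)
        - h (i + int n) (j - int n) - h (i + int n + 1) (j - int n + 1)) =
      nat (int (c i j) + h (i + 1) j + h i (j + 1) - h i j - h (i + 1) (j + 1))"
      using per ph by (simp add: periodic_def)
  qed
  have mono: "h i j \<le> h i' j'" if "i \<le> i'" "j \<le> j'" for i j i' j'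
    using column_mono[OF col that] .
  have nonneg: "0 \<le> h i j" for i j
  proof -
    have "h (min i (A - j)) j \<le> h i j" by (rule mono) auto
    moreover have "h (min i (A - j)) j = 0" by (rule past) auto
    ultimately show ?thesis by simp
  qed
  \<comment> \<open>Up to translation the level \<open>B + 2\<close> has \<open>n\<close> vertices,
    so its heights have a maximum. By monotonicity it bounds all earlier heights.\<close>
  define M where "M = Max ((\<lambda>i. h i (B + 2 - i)) ` {0..<int n})"
  have top: "h i (B + 2 - i) \<le> M" for i
  proof -
    have e: "i + (- (i div int n)) * int n = i mod int n"
      "B + 2 - i - (- (i div int n)) * int n = B + 2 - i mod int n"
      by (simp_all add: minus_div_mult_eq_mod [symmetric])
    have "h i (B + 2 - i) = h (i mod int n) (B + 2 - i mod int n)"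
      using periodic_mult[OF ph, of i "- (i div int n)" "B + 2 - i"] unfolding e by simp
    also have "\<dots> \<le> M" unfolding M_def using n by (intro Max_ge) auto
    finally show ?thesis .
  qed
  have bd: "h i j \<le> M" for i j
  proof (induction i j rule: level_induct[of "B + 2"])
    case (base i j)
    have "h i j \<le> h i (B + 2 - i)" using base by (intro mono) auto
    then show ?case using top[of i] by simp
  next
    case (step i j)
    have "c (i - 1) (j - 1) = 0" using step(1) by (intro c0) auto
    then show ?case using columnD'[OF col, of i j] step(2)[of "i-1" "j-1"] step(2)[of i "j-1"] step(2)[of "i-1" j]
      by (auto simp: box_def)
  qed
  from transit_of_bounded[OF n ph mono nonneg bd] obtain a b where ab: "transit h a b" by blast
  have "a = 0"
  proof -
    obtain B' where "\<And>i j. i + j \<le> - B' \<Longrightarrow> h i j = a" using ab unfolding transit_def by blast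
    from this[of "min (- B') A" 0] past[of "min (- B') A" 0] show ?thesis by simp
  qed
  with ab have tr: "transit h 0 b" by simp
  show ?thesis using col tr ph pd column_level_bounded(2)[OF col tr] by blast
qed

section \<open>Bi-infinite sequences of columns\<close>

text \<open>Time reversal of \<open>column_exists\<close>; adding the total \<open>H\<close> brings
  the past value of the flipped heights back to \<open>0\<close>.\<close>

lemma column_exists_back:
  assumes n: "n \<ge> 1" and per: "periodic n d" and lb: "level_bounded d"
  shows "\<exists>h c H. column h c d \<and> transit h 0 H \<and> periodic n h \<and> periodic n c \<and> level_bounded c"
proof -
  obtain h e H where h: "column h (flip_load d) e" "transit h 0 H" "periodic n h" "periodic n e" "level_bounded e"
    using column_exists[OF n periodic_flip_load[OF per] level_bounded_flip[OF lb]] by blast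
  let ?g = "\<lambda>i j. flip h i j + H"
  have "column ?g (flip_load e) d" using column_flip[OF h(1)] by (simp add: column_add)
  moreover have "transit ?g 0 H" using transit_add[OF transit_flip[OF h(2)], of H] by simp
  moreover have "periodic n ?g" using periodic_flip[OF h(3)] by (simp add: periodic_def)
  ultimately show ?thesis using periodic_flip_load[OF h(4)] level_bounded_flip[OF h(5)] by blast
qed

text \<open>The output \<open>d\<close> of the first column is the source of the second. In the
  first, \<open>d > 0\<close> forces \<open>v \<ge> k + 1\<close>, so a gain from a source in the
  second column never overtakes the first.\<close>

lemma column_decreasing:
  assumes h: "column h c d" and h': "column h' d e" and tr: "transit h a b" "transit h' a b'"
  shows "h' i j \<le> h i j"
proof -
  from tr obtain B B' where B:
    "\<And>i j. i + j \<le> - B \<Longrightarrow> h i j = a" "\<And>i j. i + j \<le> - B' \<Longrightarrow> h' i j = a"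
    unfolding transit_def by blast
  show ?thesis
  proof (induction i j rule: level_induct[of "min (- B) (- B')"])
    case (base i j) then show ?case using B by simp
  next
    case (step i j)
    show ?case using columnD'[OF h, of i j] columnD'[OF h', of i j] step(2)[of "i-1" "j-1"] step(2)[of "i-1" j] step(2)[of i "j-1"]
      by (auto simp: box_def max_def split: if_splits)
  qed
qed

text \<open>One inequality comes from \<open>column_decreasing\<close> in the far future, the other from its time
  reversal, where the order of the two columns is swapped.\<close>

lemma transit_total:
  assumes h: "column h c d" and h': "column h' d e" and tr: "transit h 0 H" "transit h' 0 H'"
  shows "H = H'"
proof -
  from tr obtain B B' where B:
    "\<And>i j. B \<le> i + j \<Longrightarrow> h i j = H" "\<And>i j. B' \<le> i + j \<Longrightarrow> h' i j = H'"
    unfolding transit_def by blast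
  have 1: "H' \<le> H" using column_decreasing[OF h h' tr, of "max B B'" 0] B[of "max B B'" 0] by simp
  let ?g = "\<lambda>i j. flip h i j + H" and ?g' = "\<lambda>i j. flip h' i j + H'"
  have g: "column ?g (flip_load d) (flip_load c)" "column ?g' (flip_load e) (flip_load d)"
    using column_flip h h' column_add by blast+
  have t: "transit ?g 0 H" "transit ?g' 0 H'"
    using transit_add[OF transit_flip[OF tr(1)], of H] transit_add[OF transit_flip[OF tr(2)], of H'] by simp_all
  from t obtain C C' where C:
    "\<And>i j. C \<le> i + j \<Longrightarrow> ?g i j = H" "\<And>i j. C' \<le> i + j \<Longrightarrow> ?g' i j = H'"
    unfolding transit_def by blast
  have "H \<le> H'" using column_decreasing[OF g(2,1) t(2,1), of "max C C'" 0] C(1)[of "max C C'" 0] C(2)[of "max C C'" 0] by simp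
  with 1 show ?thesis by simp
qed

lemma column_sequence_exists:
  assumes n: "n \<ge> 1" and per: "periodic n c0" and lb: "level_bounded c0"
  shows "\<exists>c h H. c 0 = c0 \<and> (\<forall>x::int. column (h x) (c (x - 1)) (c x) \<and> transit (h x) 0 H
           \<and> periodic n (h x) \<and> periodic n (c x) \<and> level_bounded (c x))"
proof -
  let ?good = "\<lambda>c. periodic n c \<and> level_bounded c"
  let ?next = "\<lambda>c d. \<exists>h H. column h c d \<and> transit h 0 H \<and> periodic n h"
  have "\<forall>c. \<exists>d. ?good c \<longrightarrow> ?good d \<and> ?next c d" using column_exists[OF n] by meson
  then obtain T where T: "\<And>c. ?good c \<Longrightarrow> ?good (T c) \<and> ?next c (T c)" by metis
  have "\<forall>d. \<exists>c. ?good d \<longrightarrow> ?good c \<and> ?next c d" using column_exists_back[OF n] by meson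
  then obtain U where U: "\<And>d. ?good d \<Longrightarrow> ?good (U d) \<and> ?next (U d) d" by metis
  \<comment> \<open>For \<open>x \<ge> 1\<close>, \<open>T\<close> yields \<open>c x\<close> as an
    output of \<open>c (x - 1)\<close>; for \<open>x \<le> 0\<close>, \<open>U\<close> yields
    \<open>c (x - 1)\<close> as a source producing \<open>c x\<close>. Either way consecutive loads
    are joined by a column.\<close>
  define c where "c x = (if x \<ge> 0 then (T ^^ nat x) c0 else (U ^^ nat (- x)) c0)" for x :: int
  have gT: "?good ((T ^^ k) c0)" for k by (induction k) (use per lb T in auto)
  have gU: "?good ((U ^^ k) c0)" for k by (induction k) (use per lb U in auto)
  have g: "?good (c x)" for x unfolding c_def using gT gU by simp
  have "?next (c (x - 1)) (c x)" for x
  proof (cases "x \<ge> 1")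
    case True
    then have "nat x = Suc (nat (x - 1))" by simp
    then have "c x = T (c (x - 1))" using True unfolding c_def by simp
    then show ?thesis using T[OF g[of "x - 1"]] by simp
  next
    case False
    then have "nat (- (x - 1)) = Suc (nat (- x))" by simp
    moreover have "c x = (U ^^ nat (- x)) c0" using False unfolding c_def by auto
    ultimately have "c (x - 1) = U (c x)" using False unfolding c_def by simp
    then show ?thesis using U[OF g[of x]] by simp
  qed
  then obtain h H where hH: "\<And>x. column (h x) (c (x - 1)) (c x) \<and> transit (h x) 0 (H x) \<and> periodic n (h x)"
    by metis
  have step: "H x = H (x + 1)" for x
    using transit_total[of "h x" "c (x - 1)" "c x" "h (x + 1)" "c (x + 1)"] hH[of x] hH[of "x + 1"] by auto
  have H0: "H x = H 0" for x
  proof (induction x rule: int_induct[where k = 0])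
    case (step1 x) then show ?case using step[of x] by simp
  next
    case (step2 x) then show ?case using step[of "x - 1"] by simp
  qed simp
  have "c 0 = c0" by (simp add: c_def)
  moreover have "column (h x) (c (x - 1)) (c x) \<and> transit (h x) 0 (H 0) \<and> periodic n (h x)
      \<and> periodic n (c x) \<and> level_bounded (c x)" for x
    using hH[of x] g[of x] H0[of x] by simp
  ultimately show ?thesis by blast
qed

lemma column_sequence_mono:
  fixes c :: "int \<Rightarrow> int \<Rightarrow> int \<Rightarrow> nat"
  assumes col: "\<And>x. column (h x) (c (x - 1)) (c x)" and tr: "\<And>x. transit (h x) 0 H" and "x \<le> y"
  shows "h y i j \<le> h x i j"
  using \<open>x \<le> y\<close>
proof (induction y rule: int_ge_induct)
  case (step y)
  have "column (h (y + 1)) (c y) (c (y + 1))" using col[of "y + 1"] by simp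
  from column_decreasing[OF col[of y] this tr tr] step show ?case by (meson order_trans)
qed simp

lemma transit_column_bounds:
  assumes h: "column h c d" and tr: "transit h a b"
  shows "a \<le> h i j" "h i j \<le> b"
proof -
  from tr obtain B where B: "\<And>i j. i + j \<le> - B \<Longrightarrow> h i j = a" "\<And>i j. B \<le> i + j \<Longrightarrow> h i j = b"
    unfolding transit_def by blast
  have "h (min i (- B - j)) j \<le> h i j" by (rule column_mono[OF h]) auto
  then show "a \<le> h i j" using B(1)[of "min i (- B - j)" j] by simp
  have "h i j \<le> h (max i (B - j)) j" by (rule column_mono[OF h]) auto
  then show "h i j \<le> b" using B(2)[of "max i (B - j)" j] by simp
qed

text \<open>Once the other three corners of a box have height \<open>0\<close> for all large
  \<open>x\<close>, every column with height \<open>1\<close> at the fourth uses up one unit of the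
  load at that face. The load is finite, so the height is eventually \<open>0\<close>.\<close>

lemma column_sequence_vanishes:
  fixes c :: "int \<Rightarrow> int \<Rightarrow> int \<Rightarrow> nat"
  assumes col: "\<And>x. column (h x) (c (x - 1)) (c x)" and tr: "\<And>x. transit (h x) 0 H"
  shows "\<exists>X. \<forall>x \<ge> X. h x i j = 0"
proof -
  obtain B where B: "\<And>i j. i + j \<le> - B \<Longrightarrow> h 0 i j = 0" using tr[of 0] unfolding transit_def by blast
  note ge0 = transit_column_bounds(1)[OF col tr]
  show ?thesis
  proof (induction i j rule: level_induct[of "- B"])
    case (base i j)
    \<comment> \<open>Where column \<open>0\<close> has not yet moved, later columns are squeezed
      between \<open>0\<close> and it.\<close>
    have "\<forall>x\<ge>0. h x i j = 0"
    proof (intro allI impI)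
      fix x :: int assume "0 \<le> x"
      then have "h x i j \<le> h 0 i j" by (rule column_sequence_mono[where h = h and c = c, OF col tr])
      then show "h x i j = 0" using B[OF base] ge0[of x i j] by simp
    qed
    then show ?case by blast
  next
    case (step i j)
    obtain X1 X2 X3 where X: "\<And>x. x \<ge> X1 \<Longrightarrow> h x (i - 1) (j - 1) = 0"
        "\<And>x. x \<ge> X2 \<Longrightarrow> h x i (j - 1) = 0" "\<And>x. x \<ge> X3 \<Longrightarrow> h x (i - 1) j = 0"
      using step(2)[of "i-1" "j-1"] step(2)[of i "j-1"] step(2)[of "i-1" j] by auto
    define X where "X = max X1 (max X2 X3)"
    define e where "e x = c x (i - 1) (j - 1)" for x
    have bx: "box 0 0 0 (h x i j) (e (x - 1)) (e x)" if "x \<ge> X" for x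
      using columnD'[OF col, of x i j] X that unfolding X_def e_def by simp
    have e: "e (X + int k) \<le> e X - k" for k
    proof (induction k)
      case (Suc k)
      have "X + int (Suc k) - 1 = X + int k" by simp
      with bx[of "X + int (Suc k)"] Suc show ?case by (auto simp: box_def split: if_splits)
    qed simp
    have "\<forall>x\<ge>X + int (e X) + 1. h x i j = 0"
    proof (intro allI impI)
      fix x assume x: "X + int (e X) + 1 \<le> x"
      then have "e (x - 1) = 0" using e[of "nat (x - 1 - X)"] by simp
      then show "h x i j = 0" using bx[of x] x by (simp add: box_def)
    qed
    then show ?case by blast
  qed
qed

lemma column_sequence_saturates:
  fixes c :: "int \<Rightarrow> int \<Rightarrow> int \<Rightarrow> nat"
  assumes col: "\<And>x. column (h x) (c (x - 1)) (c x)" and tr: "\<And>x. transit (h x) 0 H"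
  shows "\<exists>X. \<forall>x \<le> X. h x i j = H"
proof -
  \<comment> \<open>Reversal exchanges source and output, so the columns are listed backwards:
    column \<open>y\<close> is the flip of \<open>h (1 - y)\<close>, with the flips of
    \<open>c (1 - y)\<close> as source and of \<open>c (- y)\<close> as output.\<close>
  let ?g = "\<lambda>y i j. flip (h (1 - y)) i j + H" and ?e = "\<lambda>y. flip_load (c (- y))"
  have "column (?g y) (?e (y - 1)) (?e y)" for y
    using column_flip[OF col[of "1 - y"]] by (simp add: column_add)
  moreover have "transit (?g y) 0 H" for y
    using transit_add[OF transit_flip[OF tr[of "1 - y"]], of H] by simp
  ultimately obtain X where X: "\<And>y. y \<ge> X \<Longrightarrow> ?g y (- i) (- j) = 0"
    using column_sequence_vanishes[of ?g ?e] by blast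
  have "\<forall>x\<le>1 - X. h x i j = H"
  proof (intro allI impI)
    fix x assume "x \<le> 1 - X"
    then show "h x i j = H" using X[of "1 - x"] by (simp add: flip_def)
  qed
  then show ?thesis by blast
qed

section \<open>Signatures and their conjugates\<close>

text \<open>The entries decrease weakly, so the indices counted by \<open>conjugate lam x\<close>
  form an initial segment. All translations between entries and column heights go through this
  equivalence.\<close>

lemma conjugate_gt_iff:
  assumes "lam \<in> signatures_of_length l" "j < l"
  shows "j < conjugate lam x \<longleftrightarrow> x \<le> lam ! j"
proof -
  have len: "length lam = l" and srt: "\<And>i k. i < k \<Longrightarrow> k < l \<Longrightarrow> lam ! k \<le> lam ! i"
    using assms(1) by (auto simp: signatures_of_length_def sorted_wrt_iff_nth_less)
  show ?thesis
  proof
    assume x: "x \<le> lam ! j"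
    have "{..j} \<subseteq> {j. j < length lam \<and> x \<le> lam ! j}"
    proof
      fix i assume "i \<in> {..j}"
      then show "i \<in> {j. j < length lam \<and> x \<le> lam ! j}"
        using srt[of i j] x assms(2) len by (cases "i = j") auto
    qed
    from card_mono[OF _ this] show "j < conjugate lam x" by (simp add: conjugate_def)
  next
    assume j: "j < conjugate lam x"
    show "x \<le> lam ! j"
    proof (rule ccontr)
      assume x: "\<not> x \<le> lam ! j"
      have "{j. j < length lam \<and> x \<le> lam ! j} \<subseteq> {..<j}"
      proof
        fix i assume i: "i \<in> {j. j < length lam \<and> x \<le> lam ! j}"
        then have "\<not> j \<le> i" using srt[of j i] x len by (cases "i = j") auto
        then show "i \<in> {..<j}" by simp
      qed
      from card_mono[OF _ this] j show False by (simp add: conjugate_def)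
    qed
  qed
qed

lemma conjugate_antimono: "x \<le> y \<Longrightarrow> conjugate lam y \<le> conjugate lam x"
  unfolding conjugate_def by (rule card_mono) auto

lemma conjugate_le_length: "lam \<in> signatures_of_length l \<Longrightarrow> conjugate lam x \<le> l"
proof -
  assume "lam \<in> signatures_of_length l"
  moreover have "conjugate lam x \<le> card {..<length lam}" unfolding conjugate_def by (rule card_mono) auto
  ultimately show ?thesis by (simp add: signatures_of_length_def)
qed

lemma conjugate_filter: "conjugate lam x = length (filter (\<lambda>y. x \<le> y) lam)"
  by (simp add: conjugate_def length_filter_conv_card)

lemma conjugate_bot: "\<exists>X. \<forall>x \<le> X. conjugate lam x = length lam"
proof -
  \<comment> \<open>The inserted \<open>0\<close> covers the empty signature, whose set of entries
    has no minimum.\<close>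
  have "conjugate lam x = length lam" if "x \<le> Min (insert 0 (set lam))" for x
  proof -
    have "filter (\<lambda>y. x \<le> y) lam = lam" using that by (intro filter_True) auto
    then show ?thesis by (simp add: conjugate_filter)
  qed
  then show ?thesis by blast
qed

lemma conjugate_top: "\<exists>X. \<forall>x \<ge> X. conjugate lam x = 0"
proof -
  have "conjugate lam x = 0" if x: "x \<ge> Max (insert 0 (set lam)) + 1" for x
  proof -
    have "y < x" if "y \<in> set lam" for y
    proof -
      have "y \<le> Max (insert 0 (set lam))" using that by (intro Max_ge) auto
      then show ?thesis using x by linarith
    qed
    then show ?thesis by (force simp: conjugate_filter filter_empty_conv)
  qed
  then show ?thesis by blast
qed

text \<open>The length is the value at very negative arguments, and entry \<open>j\<close> is the
  largest \<open>x\<close> with \<open>j < conjugate lam x\<close>.\<close>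

lemma conjugate_inj:
  assumes "lam \<in> signatures_of_length l" "mu \<in> signatures_of_length l'" "conjugate lam = conjugate mu"
  shows "lam = mu"
proof (rule nth_equalityI)
  obtain X Y where "\<And>x. x \<le> X \<Longrightarrow> conjugate lam x = length lam" "\<And>x. x \<le> Y \<Longrightarrow> conjugate mu x = length mu"
    using conjugate_bot by meson
  from this(1)[of "min X Y"] this(2)[of "min X Y"] show len: "length lam = length mu" using assms(3) by simp
  fix j assume "j < length lam"
  then have "x \<le> lam ! j \<longleftrightarrow> x \<le> mu ! j" for x
    using conjugate_gt_iff[OF assms(1), of j x] conjugate_gt_iff[OF assms(2), of j x] assms len
    by (simp add: signatures_of_length_def)
  from this[of "lam ! j"] this[of "mu ! j"] show "lam ! j = mu ! j" by simp
qed

text \<open>The set of \<open>x\<close> with \<open>j < f x\<close> is closed downwards, contains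
  \<open>X\<close> and lies below \<open>Y\<close>; its maximum will be entry \<open>j\<close> of a
  signature.\<close>

lemma int_threshold:
  fixes f :: "int \<Rightarrow> nat"
  assumes anti: "\<And>x. f (x + 1) \<le> f x" and "j < f X" "f Y \<le> j"
  shows "\<exists>a. \<forall>x. x \<le> a \<longleftrightarrow> j < f x"
proof -
  have mono: "f y \<le> f x" if "x \<le> y" for x y
    using that by (induction y rule: int_ge_induct) (auto intro: order_trans[OF anti])
  let ?S = "{x. X \<le> x \<and> j < f x}"
  have "?S \<subseteq> {X..Y}"
  proof
    fix x assume "x \<in> ?S"
    then show "x \<in> {X..Y}" using mono[of Y x] assms(3) by (cases "Y \<le> x") auto
  qed
  then have fin: "finite ?S" using finite_subset by blast
  have "X \<in> ?S" using assms by simp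
  then have M: "Max ?S \<in> ?S" using Max_in[OF fin] by blast
  have "x \<le> Max ?S \<longleftrightarrow> j < f x" for x
  proof
    assume "x \<le> Max ?S" then show "j < f x" using mono[of x "Max ?S"] M by simp
  next
    assume jx: "j < f x"
    show "x \<le> Max ?S"
    proof (cases "X \<le> x")
      case True then show ?thesis using jx by (intro Max_ge[OF fin]) simp
    next
      case False then show ?thesis using M by simp
    qed
  qed
  then show ?thesis by blast
qed

lemma signature_of_threshold:
  fixes f :: "int \<Rightarrow> nat"
  assumes anti: "\<And>x. f (x + 1) \<le> f x" and le: "\<And>x. f x \<le> l"
    and g: "\<And>j x. j < l \<Longrightarrow> x \<le> g j \<longleftrightarrow> j < f x"
  shows "map g [0..<l] \<in> signatures_of_length l" "conjugate (map g [0..<l]) = f"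
proof -
  have "g k \<le> g j" if "j < k" "k < l" for j k
    using g[of k "g k"] g[of j "g k"] that by simp
  then show "map g [0..<l] \<in> signatures_of_length l"
    by (simp add: signatures_of_length_def sorted_wrt_iff_nth_less)
  show "conjugate (map g [0..<l]) = f"
  proof
    fix x
    have "{j. j < length (map g [0..<l]) \<and> x \<le> map g [0..<l] ! j} = {..<f x}"
      using g le[of x] by (auto intro: less_le_trans)
    then show "conjugate (map g [0..<l]) x = f x" by (simp add: conjugate_def)
  qed
qed

text \<open>With \<open>conjugate_inj\<close> this identifies the signatures of length
  \<open>l\<close> with the antitone functions that are \<open>l\<close> far to the left and
  \<open>0\<close> far to the right.\<close>

lemma signature_of_conjugate:
  fixes f :: "int \<Rightarrow> nat"
  assumes anti: "\<And>x. f (x + 1) \<le> f x" and bot: "\<And>x. x \<le> X \<Longrightarrow> f x = l" and top: "f Y = 0"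
  shows "\<exists>lam \<in> signatures_of_length l. conjugate lam = f"
proof -
  have "\<exists>a. \<forall>x. x \<le> a \<longleftrightarrow> j < f x" if "j < l" for j
    using that bot[of X] top by (intro int_threshold[of f j X Y] anti) auto
  then obtain g where g: "\<And>j x. j < l \<Longrightarrow> x \<le> g j \<longleftrightarrow> j < f x" by metis
  have mono: "f y \<le> f x" if "x \<le> y" for x y
    using that by (induction y rule: int_ge_induct) (auto intro: order_trans[OF anti])
  have "f x \<le> l" for x using mono[of "min x X" x] bot[of "min x X"] by simp
  from signature_of_threshold[OF anti this g] show ?thesis by blast
qed

text \<open>Through \<open>conjugate_gt_iff\<close>, comparing entries of equal index corresponds to
  the lower bound, and comparing entries with the index shifted by one to the upper bound.\<close>

lemma interlaces_iff:
  assumes "kap \<in> signatures_of_length l" "mu \<in> signatures_of_length l"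
  shows "kap \<preceq> mu \<longleftrightarrow> (\<forall>x. conjugate kap x \<le> conjugate mu x \<and> conjugate mu x \<le> conjugate kap x + 1)"
proof -
  note k = conjugate_gt_iff[OF assms(1)] and m = conjugate_gt_iff[OF assms(2)]
  have len: "length kap = l" "length mu = l" using assms by (auto simp: signatures_of_length_def)
  show ?thesis
  proof
    assume il: "kap \<preceq> mu"
    show "\<forall>x. conjugate kap x \<le> conjugate mu x \<and> conjugate mu x \<le> conjugate kap x + 1"
    proof (intro allI conjI)
      fix x
      show "conjugate kap x \<le> conjugate mu x"
        unfolding conjugate_def
      proof (rule card_mono)
        show "{j. j < length kap \<and> x \<le> kap ! j} \<subseteq> {j. j < length mu \<and> x \<le> mu ! j}"
          using il by (auto simp: interlaces_def intro: order_trans)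
      qed simp
      show "conjugate mu x \<le> conjugate kap x + 1"
      proof (rule ccontr)
        define i where "i = conjugate kap x"
        assume "\<not> conjugate mu x \<le> conjugate kap x + 1"
        then have i: "Suc i < conjugate mu x" unfolding i_def by simp
        then have "Suc i < l" using conjugate_le_length[OF assms(2), of x] by simp
        then have "x \<le> mu ! Suc i" "mu ! Suc i \<le> kap ! i" using i m[of "Suc i" x] il len by (auto simp: interlaces_def)
        then have "i < conjugate kap x" using k[of i x] \<open>Suc i < l\<close> by simp
        then show False unfolding i_def by simp
      qed
    qed
  next
    assume c: "\<forall>x. conjugate kap x \<le> conjugate mu x \<and> conjugate mu x \<le> conjugate kap x + 1"
    show "kap \<preceq> mu"
      unfolding interlaces_def
    proof (intro conjI allI impI)
      show "length kap = length mu" using len by simp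
      fix i assume i: "i < length mu"
      show "kap ! i \<le> mu ! i"
        using i len k[of i "kap ! i"] m[of i "kap ! i"] c by (metis order.strict_trans2 order_refl)
    next
      fix i assume i: "Suc i < length mu"
      have "Suc i < conjugate mu (mu ! Suc i)" using m[of "Suc i" "mu ! Suc i"] i len by simp
      then have "i < conjugate kap (mu ! Suc i)" using spec[OF c, of "mu ! Suc i"] by simp
      then show "mu ! Suc i \<le> kap ! i" using k[of i "mu ! Suc i"] i len by simp
    qed
  qed
qed

lemma interlaces_signature:
  assumes "kap \<preceq> mu" "kap \<in> signatures_of_length l" "mu \<in> signatures"
  shows "mu \<in> signatures_of_length l"
  using assms by (auto simp: signatures_def signatures_of_length_def interlaces_def)

section \<open>The local rule\<close>

text \<open>Connects the last passage form with the carrier recursion of the local rule, whose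
  increments at \<open>x\<close> are \<open>m - k\<close> and \<open>l - k\<close>. Both lie in
  \<open>{0, 1}\<close>, which leaves few cases.\<close>

lemma box_iff:
  "box k m l v c d \<longleftrightarrow> k \<le> m \<and> m \<le> k + 1 \<and> k \<le> l \<and> l \<le> k + 1
     \<and> int d = max 0 ((m - k) + (l - k) + int c - 1) \<and> v = m + l - k + int c - int d"
  by (auto simp: box_def max_def split: if_splits)

lemma box_trivial: "box a a a v 0 d \<Longrightarrow> v = a"
  by (simp add: box_def)

text \<open>A relational form of the local rule that avoids definite descriptions and exposes the
  whole carrier sequence, hence all columns at once.\<close>

definition fomin_square ::
    "int list \<Rightarrow> int list \<Rightarrow> int list \<Rightarrow> int list \<Rightarrow> (int \<Rightarrow> nat) \<Rightarrow> bool" where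
  "fomin_square kap mu lam nu c \<longleftrightarrow> (\<exists>X. \<forall>x \<le> X. c x = 0) \<and>
     (\<forall>x. box (conjugate kap x) (conjugate mu x) (conjugate lam x) (conjugate nu x) (c (x - 1)) (c x))"

lemma carrier_recursion_unique:
  fixes c c' :: "int \<Rightarrow> nat"
  assumes "\<forall>x \<le> X. c x = 0" "\<forall>x \<le> X'. c' x = 0"
    and r: "\<And>x. int (c x) = max 0 (D x + int (c (x - 1)) - 1)" "\<And>x. int (c' x) = max 0 (D x + int (c' (x - 1)) - 1)"
  shows "c = c'"
proof
  fix x
  have "c (min X X' + int k) = c' (min X X' + int k)" for k
  proof (induction k)
    case (Suc k)
    have e: "min X X' + int (Suc k) - 1 = min X X' + int k" by simp
    show ?case using r[of "min X X' + int (Suc k)"] Suc unfolding e by simp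
  qed (use assms in simp)
  from this[of "nat (x - min X X')"] show "c x = c' x"
    using assms(1,2) by (cases "x \<le> min X X'") auto
qed

lemma carrier_recursion_exists:
  fixes D :: "int \<Rightarrow> int"
  assumes "\<And>x. x \<le> X \<Longrightarrow> D x = 0"
  shows "\<exists>c::int \<Rightarrow> nat. (\<forall>x \<le> X. c x = 0) \<and> (\<forall>x. int (c x) = max 0 (D x + int (c (x - 1)) - 1))"
proof -
  \<comment> \<open>\<open>r k\<close> is the load at \<open>X + k\<close>; up to \<open>X\<close>
    the increments vanish and the load stays \<open>0\<close>.\<close>
  define r where "r = rec_nat (0::nat) (\<lambda>k a. nat (D (X + int k + 1) + int a - 1))"
  define c where "c x = r (nat (x - X))" for x
  have 0: "c x = 0" if "x \<le> X" for x using that by (simp add: c_def r_def)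
  have "int (c x) = max 0 (D x + int (c (x - 1)) - 1)" for x
  proof (cases "x \<le> X")
    case True then show ?thesis using 0[of x] 0[of "x - 1"] assms by simp
  next
    case False
    then have "nat (x - X) = Suc (nat (x - 1 - X))" "X + int (nat (x - 1 - X)) + 1 = x" by auto
    then have "c x = nat (D x + int (c (x - 1)) - 1)" unfolding c_def r_def by simp
    then show ?thesis by simp
  qed
  then show ?thesis using 0 by blast
qed

lemma fomin_square_exists:
  assumes sig: "kap \<in> signatures_of_length l" "mu \<in> signatures_of_length l" "lam \<in> signatures_of_length l"
    and il: "kap \<preceq> mu" "kap \<preceq> lam"
  shows "\<exists>nu c. nu \<in> signatures_of_length l \<and> fomin_square kap mu lam nu c"
proof -
  let ?k = "\<lambda>x. int (conjugate kap x)" and ?m = "\<lambda>x. int (conjugate mu x)" and ?l = "\<lambda>x. int (conjugate lam x)"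
  have len: "length kap = l" "length mu = l" "length lam = l" using sig by (auto simp: signatures_of_length_def)
  obtain X1 where X1: "\<forall>x \<le> X1. conjugate kap x = l" using conjugate_bot[of kap] len by auto
  obtain X2 where X2: "\<forall>x \<le> X2. conjugate mu x = l" using conjugate_bot[of mu] len by auto
  obtain X3 where X3: "\<forall>x \<le> X3. conjugate lam x = l" using conjugate_bot[of lam] len by auto
  define X where "X = min X1 (min X2 X3)"
  have X: "conjugate kap x = l \<and> conjugate mu x = l \<and> conjugate lam x = l" if "x \<le> X" for x
    using that X1 X2 X3 unfolding X_def by simp
  obtain Y1 where Y1: "\<forall>x \<ge> Y1. conjugate kap x = 0" using conjugate_top by blast
  obtain Y2 where Y2: "\<forall>x \<ge> Y2. conjugate mu x = 0" using conjugate_top by blast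
  obtain Y3 where Y3: "\<forall>x \<ge> Y3. conjugate lam x = 0" using conjugate_top by blast
  define Y where "Y = max Y1 (max Y2 Y3)"
  have Y: "conjugate kap x = 0 \<and> conjugate mu x = 0 \<and> conjugate lam x = 0" if "x \<ge> Y" for x
    using that Y1 Y2 Y3 unfolding Y_def by simp
  define D where "D x = (?m x - ?k x) + (?l x - ?k x)" for x
  have "D x = 0" if "x \<le> X" for x using X[OF that] unfolding D_def by simp
  from carrier_recursion_exists[OF this] obtain c :: "int \<Rightarrow> nat" where
    cc: "(\<forall>x \<le> X. c x = 0) \<and> (\<forall>x. int (c x) = max 0 (D x + int (c (x - 1)) - 1))" ..
  note c = conjunct1[OF cc, rule_format] conjunct2[OF cc, rule_format]
  define v where "v x = nat (?m x + ?l x - ?k x + int (c (x - 1)) - int (c x))" for x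
  have kml: "?k x \<le> ?m x" "?m x \<le> ?k x + 1" "?k x \<le> ?l x" "?l x \<le> ?k x + 1" for x
  proof -
    have "conjugate kap x \<le> conjugate mu x \<and> conjugate mu x \<le> conjugate kap x + 1"
      using il(1) interlaces_iff[OF sig(1,2)] by blast
    then show "?k x \<le> ?m x" "?m x \<le> ?k x + 1" by linarith+
    have "conjugate kap x \<le> conjugate lam x \<and> conjugate lam x \<le> conjugate kap x + 1"
      using il(2) interlaces_iff[OF sig(1,3)] by blast
    then show "?k x \<le> ?l x" "?l x \<le> ?k x + 1" by linarith+
  qed
  have bx: "box (?k x) (?m x) (?l x) (v x) (c (x - 1)) (c x)" for x
    unfolding box_iff v_def using kml[of x] c(2)[of x] unfolding D_def by auto
  \<comment> \<open>Neighbouring boxes share the load \<open>c x\<close>, and \<open>c x > 0\<close>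
    forces \<open>v x\<close> above the height of \<open>kap\<close> at \<open>x\<close>, as in
    \<open>column_decreasing\<close>.\<close>
  have anti: "v (x + 1) \<le> v x" for x
    using bx[of x] bx[of "x + 1"] conjugate_antimono[of x "x + 1" kap] conjugate_antimono[of x "x + 1" mu]
      conjugate_antimono[of x "x + 1" lam]
    by (auto simp: box_def max_def split: if_splits)
  have bot: "v x = l" if "x \<le> X" for x
  proof -
    have "c x = 0" "c (x - 1) = 0" using that by (auto intro!: c(1))
    with bx[of x] X[OF that] have "box (int l) (int l) (int l) (int (v x)) 0 0" by (simp only:)
    from box_trivial[OF this] show ?thesis by (simp only: of_nat_eq_iff)
  qed
  \<comment> \<open>Right of \<open>Y\<close> the increments vanish and each step removes one unit,
    so the load is used up after \<open>c Y\<close> steps; from then on \<open>v\<close> is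
    \<open>0\<close>.\<close>
  have "c (Y + int k) \<le> c Y - k" for k
  proof (induction k)
    case (Suc k)
    have "D (Y + int (Suc k)) = 0" using Y[of "Y + int (Suc k)"] unfolding D_def by simp
    moreover have "Y + int (Suc k) - 1 = Y + int k" by simp
    ultimately have "int (c (Y + int (Suc k))) = max 0 (int (c (Y + int k)) - 1)"
      using c(2)[of "Y + int (Suc k)"] by (simp only:)
    then show ?case using Suc by simp
  qed simp
  from this[of "c Y"] have z: "c (Y + int (c Y)) = 0" by simp
  have "v (Y + int (c Y) + 1) = 0"
  proof -
    let ?y = "Y + int (c Y) + 1"
    have "c (?y - 1) = 0" using z by simp
    with bx[of ?y] Y[of ?y] have "box 0 0 0 (int (v ?y)) 0 (c ?y)" by (simp only:) simp
    from box_trivial[OF this] show ?thesis by (simp only: of_nat_eq_0_iff)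
  qed
  from signature_of_conjugate[of v, OF anti bot this] obtain nu where
    nu: "nu \<in> signatures_of_length l" "conjugate nu = v" by blast
  have "fomin_square kap mu lam nu c"
    unfolding fomin_square_def using bx c(1) nu(2) by blast
  then show ?thesis using nu(1) by blast
qed

text \<open>The recursion has only one solution that starts from zero, and a conjugate determines
  its signature, so exhibiting a square evaluates both definite descriptions.\<close>

lemma fomin_square_unique:
  assumes f: "fomin_square kap mu lam nu c" and sig: "nu \<in> signatures_of_length l" "length kap = l"
  shows "carrier_load kap mu lam = c" "fomin_rule kap mu lam = nu"
proof -
  obtain X where X: "\<forall>x \<le> X. c x = 0" using f unfolding fomin_square_def by blast
  have bx: "box (conjugate kap x) (conjugate mu x) (conjugate lam x) (conjugate nu x) (c (x - 1)) (c x)" for x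
    using f unfolding fomin_square_def by blast
  define D where "D x = (int (conjugate mu x) - int (conjugate kap x)) + (int (conjugate lam x) - int (conjugate kap x))" for x
  have r: "int (c x) = max 0 (D x + int (c (x - 1)) - 1)" for x
    using bx[of x] unfolding box_iff D_def by blast
  show cl: "carrier_load kap mu lam = c"
    unfolding carrier_load_def D_def [symmetric]
  proof (rule the_equality)
    show "eventually (\<lambda>x. c x = 0) at_bot \<and> (\<forall>x. int (c x) = max 0 (D x + int (c (x - 1)) - 1))"
      using X r unfolding eventually_at_bot_linorder by blast
    fix c' assume c': "eventually (\<lambda>x. c' x = 0) at_bot \<and> (\<forall>x. int (c' x) = max 0 (D x + int (c' (x - 1)) - 1))"
    then obtain X' where "\<forall>x \<le> X'. c' x = 0" unfolding eventually_at_bot_linorder by blast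
    from carrier_recursion_unique[OF this X _ r] c' show "c' = c" by blast
  qed
  have v: "int (conjugate nu x) = int (conjugate mu x) + int (conjugate lam x) - int (conjugate kap x)
        + int (c (x - 1)) - int (c x)" for x
    using bx[of x] unfolding box_iff by simp
  show "fomin_rule kap mu lam = nu"
    unfolding fomin_rule_def cl
  proof (rule the_equality)
    fix nu' assume n: "nu' \<in> signatures_of_length (length kap) \<and>
         (\<forall>x. int (conjugate nu' x) =
              int (conjugate mu x) + int (conjugate lam x) - int (conjugate kap x) + int (c (x - 1)) - int (c x))"
    then have "int (conjugate nu' x) = int (conjugate nu x)" for x using v[of x] by (simp only:)
    then have "conjugate nu' = conjugate nu" by (simp add: fun_eq_iff)
    then show "nu' = nu" using conjugate_inj n sig by blast
  qed (use v sig in blast)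
qed

lemma fomin_square_rule:
  assumes "kap \<in> signatures_of_length l" "mu \<in> signatures_of_length l" "lam \<in> signatures_of_length l"
    and "kap \<preceq> mu" "kap \<preceq> lam"
  shows "fomin_rule kap mu lam \<in> signatures_of_length l"
    "fomin_square kap mu lam (fomin_rule kap mu lam) (carrier_load kap mu lam)"
proof -
  obtain nu c where *: "nu \<in> signatures_of_length l" "fomin_square kap mu lam nu c"
    using fomin_square_exists[OF assms] by blast
  have "length kap = l" using assms(1) by (simp add: signatures_of_length_def)
  from fomin_square_unique[OF *(2,1) this] *
  show "fomin_rule kap mu lam \<in> signatures_of_length l"
    "fomin_square kap mu lam (fomin_rule kap mu lam) (carrier_load kap mu lam)" by simp_all
qed

section \<open>Interlacing and time reversal of squares\<close>

lemma box_steps: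
  assumes "box (int k) (int m) (int l) (int v) c d"
  shows "k \<le> m" "m \<le> k + 1" "k \<le> l" "l \<le> k + 1" "m \<le> v" "v \<le> m + 1" "l \<le> v" "v \<le> l + 1"
proof -
  have "int k \<le> int m" "int m \<le> int k + 1" "int k \<le> int l" "int l \<le> int k + 1"
    using assms unfolding box_def by blast+
  moreover from this have "int m \<le> int v" "int v \<le> int m + 1" "int l \<le> int v" "int v \<le> int l + 1"
    using assms unfolding box_def by (auto simp only: split: if_splits)
  ultimately show "k \<le> m" "m \<le> k + 1" "k \<le> l" "l \<le> k + 1" "m \<le> v" "v \<le> m + 1" "l \<le> v" "v \<le> l + 1"
    by linarith+
qed

lemma fomin_square_interlaces:
  assumes f: "fomin_square kap mu lam nu c"
    and sig: "kap \<in> signatures_of_length l" "mu \<in> signatures_of_length l"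
      "lam \<in> signatures_of_length l" "nu \<in> signatures_of_length l"
  shows "kap \<preceq> mu" "kap \<preceq> lam" "mu \<preceq> nu" "lam \<preceq> nu"
proof -
  have b: "box (conjugate kap x) (conjugate mu x) (conjugate lam x) (conjugate nu x) (c (x - 1)) (c x)" for x
    using f unfolding fomin_square_def by blast
  show "kap \<preceq> mu" "kap \<preceq> lam" "mu \<preceq> nu" "lam \<preceq> nu"
    unfolding interlaces_iff[OF sig(1,2)] interlaces_iff[OF sig(1,3)] interlaces_iff[OF sig(2,4)] interlaces_iff[OF sig(3,4)]
    using box_steps[OF b] by blast+
qed

text \<open>Beyond the entries of all four signatures \<open>box_const\<close> empties the carrier.
  Reversal turns this end into the one where the carrier starts.\<close>

lemma fomin_square_top:
  assumes "fomin_square kap mu lam nu c"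
  shows "\<exists>Y. \<forall>x \<ge> Y. c x = 0"
proof -
  have bx: "box (conjugate kap x) (conjugate mu x) (conjugate lam x) (conjugate nu x) (c (x - 1)) (c x)" for x
    using assms unfolding fomin_square_def by blast
  obtain Y1 where Y1: "\<forall>x \<ge> Y1. conjugate kap x = 0" using conjugate_top by blast
  obtain Y2 where Y2: "\<forall>x \<ge> Y2. conjugate mu x = 0" using conjugate_top by blast
  obtain Y3 where Y3: "\<forall>x \<ge> Y3. conjugate lam x = 0" using conjugate_top by blast
  obtain Y4 where Y4: "\<forall>x \<ge> Y4. conjugate nu x = 0" using conjugate_top by blast
  have "c x = 0" if "x \<ge> max (max Y1 Y2) (max Y3 Y4)" for x
    using bx[of x] Y1 Y2 Y3 Y4 that by (simp add: box_const[of 0])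
  then show ?thesis by blast
qed

text \<open>The counterpart of \<open>flip\<close> for signatures: the conjugate is negated up to
  the constant \<open>l\<close> and its argument is reflected
  (\<open>conjugate_reverse\<close>).\<close>

definition reverse_signature :: "int list \<Rightarrow> int list" where
  "reverse_signature lam = rev (map uminus lam)"

lemma reverse_reverse [simp]: "reverse_signature (reverse_signature lam) = lam"
  by (simp add: reverse_signature_def rev_map comp_def)

lemma reverse_signature_in [simp]:
  "reverse_signature lam \<in> signatures_of_length l \<longleftrightarrow> lam \<in> signatures_of_length l"
  by (simp add: reverse_signature_def signatures_of_length_def rev_map sorted_wrt_rev sorted_wrt_map)

text \<open>For integers, \<open>x \<le> - y\<close> is the negation of
  \<open>1 - x \<le> y\<close>, so the two counts add up to the length.\<close>

lemma conjugate_reverse: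
  assumes "lam \<in> signatures_of_length l"
  shows "int (conjugate (reverse_signature lam) x) = int l - int (conjugate lam (1 - x))"
proof -
  have "conjugate (reverse_signature lam) x = length (filter (\<lambda>y. \<not> 1 - x \<le> y) lam)"
  proof -
    have "filter (\<lambda>y. x \<le> - y) lam = filter (\<lambda>y. \<not> 1 - x \<le> y) lam" by (rule filter_cong) auto
    then show ?thesis
      by (simp add: conjugate_filter reverse_signature_def rev_filter [symmetric] filter_map comp_def)
  qed
  then show ?thesis
    using sum_length_filter_compl[of "\<lambda>y. 1 - x \<le> y" lam] assms
    by (simp add: conjugate_filter signatures_of_length_def)
qed

lemma fomin_square_reverse:
  assumes f: "fomin_square kap mu lam nu c"
    and sig: "kap \<in> signatures_of_length l" "mu \<in> signatures_of_length l"
      "lam \<in> signatures_of_length l" "nu \<in> signatures_of_length l"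
  shows "fomin_square (reverse_signature nu) (reverse_signature lam) (reverse_signature mu)
    (reverse_signature kap) (\<lambda>x. c (- x))"
  unfolding fomin_square_def
proof (intro conjI allI)
  obtain Y where Y: "\<And>x. x \<ge> Y \<Longrightarrow> c x = 0" using fomin_square_top[OF f] by blast
  then have "\<forall>x\<le>- Y. c (- x) = 0" by simp
  then show "\<exists>X. \<forall>x\<le>X. c (- x) = 0" by blast
  fix x
  have "box (conjugate kap (1 - x)) (conjugate mu (1 - x)) (conjugate lam (1 - x)) (conjugate nu (1 - x)) (c (1 - x - 1)) (c (1 - x))"
    using f unfolding fomin_square_def by blast
  from box_flip[OF this] have "box (- int (conjugate nu (1 - x)) + int l) (- int (conjugate lam (1 - x)) + int l)
     (- int (conjugate mu (1 - x)) + int l) (- int (conjugate kap (1 - x)) + int l) (c (1 - x)) (c (- x))"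
    unfolding box_add by simp
  moreover have "- (x - 1) = 1 - x" by simp
  ultimately show "box (conjugate (reverse_signature nu) x) (conjugate (reverse_signature lam) x)
      (conjugate (reverse_signature mu) x) (conjugate (reverse_signature kap) x) (c (- (x - 1))) (c (- x))"
    using sig by (simp add: conjugate_reverse)
qed

section \<open>Limits of signatures\<close>

text \<open>Entries with index below the maximum of \<open>al\<close> converge to the thresholds of
  \<open>al\<close>. Any other entry eventually falls below every bound, since \<open>al x\<close>
  never exceeds its index. So the limit has the maximum of \<open>al\<close> as its length.\<close>

lemma limit_signature_conjugate:
  assumes sig: "\<And>t. s t \<in> signatures_of_length l"
    and lim: "\<And>x. \<exists>T. \<forall>t \<le> T. conjugate (s t) x = al x" and top: "al Y = 0"
  shows "limit_signature l s \<in> signatures" "conjugate (limit_signature l s) = al"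
proof -
  obtain T where T: "\<And>x t. t \<le> T x \<Longrightarrow> conjugate (s t) x = al x" using lim by metis
  have le: "al x \<le> l" for x using T[of "T x" x] conjugate_le_length[OF sig, of "T x" x] by simp
  have anti: "al (x + 1) \<le> al x" for x
    using T[of "min (T x) (T (x + 1))" x] T[of "min (T x) (T (x + 1))" "x + 1"]
      conjugate_antimono[of x "x + 1" "s (min (T x) (T (x + 1)))"] by simp
  define m where "m = Max (range al)"
  have "range al \<subseteq> {..l}" using le by auto
  then have fin: "finite (range al)" using finite_subset by blast
  have alm: "al x \<le> m" for x unfolding m_def using fin by simp
  obtain X where X: "al X = m" using Max_in[OF fin] unfolding m_def by auto
  have ml: "m \<le> l" using le[of X] X by simp
  have "\<exists>a. \<forall>x. x \<le> a \<longleftrightarrow> r < al x" if "r < m" for r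
    using that X top by (intro int_threshold[of al r X Y] anti) auto
  then obtain g where g: "\<And>r x. r < m \<Longrightarrow> x \<le> g r \<longleftrightarrow> r < al x" by metis
  have tend: "((\<lambda>t. s t ! r) \<longlongrightarrow> g r) at_bot" if r: "r < m" for r
  proof (rule tendsto_eventually)
    have "s t ! r = g r" if t: "t \<le> min (T (g r)) (T (g r + 1))" for t
    proof -
      have "r < conjugate (s t) (g r)" "\<not> r < conjugate (s t) (g r + 1)"
        using T[of t "g r"] T[of t "g r + 1"] t g[OF r, of "g r"] g[OF r, of "g r + 1"] by auto
      then show ?thesis using conjugate_gt_iff[OF sig, of r t] r ml by force
    qed
    then show "eventually (\<lambda>t. s t ! r = g r) at_bot" unfolding eventually_at_bot_linorder by blast
  qed
  have notend: "\<not> ((\<lambda>t. s t ! r) \<longlongrightarrow> a) at_bot" if r: "m \<le> r" "r < l" for r a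
  proof
    assume "((\<lambda>t. s t ! r) \<longlongrightarrow> a) at_bot"
    then obtain N where N: "\<And>t. t \<le> N \<Longrightarrow> s t ! r = a"
      unfolding tendsto_discrete eventually_at_bot_linorder by blast
    have "r < conjugate (s (min N (T a))) a"
      using conjugate_gt_iff[OF sig r(2), of "min N (T a)" a] N[of "min N (T a)"] by simp
    then show False using T[of "min N (T a)" a] alm[of a] r by simp
  qed
  have "{i \<in> {1..l}. \<exists>a. ((\<lambda>t. s t ! (i - 1)) \<longlongrightarrow> a) at_bot} = {1..m}"
  proof (intro set_eqI iffI)
    fix i assume i: "i \<in> {i \<in> {1..l}. \<exists>a. ((\<lambda>t. s t ! (i - 1)) \<longlongrightarrow> a) at_bot}"
    then have "\<not> m \<le> i - 1" using notend[of "i - 1"] by auto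
    then show "i \<in> {1..m}" using i by auto
  next
    fix i assume "i \<in> {1..m}"
    then show "i \<in> {i \<in> {1..l}. \<exists>a. ((\<lambda>t. s t ! (i - 1)) \<longlongrightarrow> a) at_bot}"
      using tend[of "i - 1"] ml by (force intro: exI[of _ "g (i - 1)"])
  qed
  then have ll: "limit_length l s = m" unfolding limit_length_def Let_def by (auto simp: Max_eq_iff)
  have "limit_signature l s = map g [0..<m]"
  proof (rule nth_equalityI)
    fix i assume "i < length (limit_signature l s)"
    then have i: "i < m" by (simp add: limit_signature_def ll del: upt_Suc)
    then have "limit_signature l s ! i = Lim at_bot (\<lambda>t. s t ! i)"
      by (simp add: limit_signature_def ll del: upt_Suc)
    also have "\<dots> = g i" using tend[OF i] by (intro tendsto_Lim) (simp_all add: trivial_limit_at_bot_linorder)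
    finally show "limit_signature l s ! i = map g [0..<m] ! i" using i by simp
  qed (simp add: limit_signature_def ll del: upt_Suc)
  then show "limit_signature l s \<in> signatures" "conjugate (limit_signature l s) = al"
    using signature_of_threshold[OF anti alm g] unfolding signatures_def by auto
qed

section \<open>Fomin fields on the universal cover\<close>

definition plane_field :: "nat \<Rightarrow> nat \<Rightarrow> (int \<Rightarrow> int \<Rightarrow> int list) \<Rightarrow> bool" where
  "plane_field n l L \<longleftrightarrow> periodic n L \<and> (\<forall>i j. L i j \<in> signatures_of_length l) \<and>
     (\<forall>i j. \<exists>c. fomin_square (L i j) (L (i + 1) j) (L i (j + 1)) (L (i + 1) (j + 1)) c)"

lemma signature_length: "lam \<in> signatures_of_length l \<Longrightarrow> length lam = l"
  by (simp add: signatures_of_length_def)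

lemma plane_field_square:
  assumes "plane_field n l L"
  shows "fomin_square (L i j) (L (i + 1) j) (L i (j + 1)) (L (i + 1) (j + 1))
           (carrier_load (L i j) (L (i + 1) j) (L i (j + 1)))"
    and "fomin_rule (L i j) (L (i + 1) j) (L i (j + 1)) = L (i + 1) (j + 1)"
proof -
  obtain c where c: "fomin_square (L i j) (L (i + 1) j) (L i (j + 1)) (L (i + 1) (j + 1)) c"
    using assms unfolding plane_field_def by blast
  have "L (i + 1) (j + 1) \<in> signatures_of_length l" "length (L i j) = l"
    using assms unfolding plane_field_def by (auto simp: signature_length)
  from fomin_square_unique[OF c this] c
  show "fomin_square (L i j) (L (i + 1) j) (L i (j + 1)) (L (i + 1) (j + 1))
           (carrier_load (L i j) (L (i + 1) j) (L i (j + 1)))"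
    "fomin_rule (L i j) (L (i + 1) j) (L i (j + 1)) = L (i + 1) (j + 1)" by simp_all
qed

lemma plane_field_iff:
  "plane_field n l L \<longleftrightarrow> periodic n L \<and> (\<forall>i j. L i j \<in> signatures_of_length l) \<and>
     (\<forall>i j. L i j \<preceq> L (i + 1) j \<and> L i j \<preceq> L i (j + 1) \<and>
        L (i + 1) (j + 1) = fomin_rule (L i j) (L (i + 1) j) (L i (j + 1)))" (is "_ \<longleftrightarrow> ?R")
proof
  assume L: "plane_field n l L"
  then have s: "L i j \<in> signatures_of_length l" for i j unfolding plane_field_def by blast
  have "L i j \<preceq> L (i + 1) j \<and> L i j \<preceq> L i (j + 1) \<and>
        L (i + 1) (j + 1) = fomin_rule (L i j) (L (i + 1) j) (L i (j + 1))" for i j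
    using fomin_square_interlaces[OF plane_field_square(1)[OF L] s s s s, of i j]
      plane_field_square(2)[OF L, of i j] by simp
  then show ?R using L unfolding plane_field_def by blast
next
  assume R: ?R
  then have s: "L i j \<in> signatures_of_length l" for i j by blast
  have "\<exists>c. fomin_square (L i j) (L (i + 1) j) (L i (j + 1)) (L (i + 1) (j + 1)) c" for i j
    using fomin_square_rule(2)[OF s s s, of i j "i + 1" j i "j + 1"] R by metis
  then show "plane_field n l L" using R unfolding plane_field_def by blast
qed

lemma plane_field_reverse:
  assumes "plane_field n l L"
  shows "plane_field n l (\<lambda>i j. reverse_signature (L (a - i) (b - j)))"
  unfolding plane_field_def
proof (intro conjI allI)
  have per: "L (i + int n) (j - int n) = L i j" for i j using assms unfolding plane_field_def periodic_def by blast
  have s: "L i j \<in> signatures_of_length l" for i j using assms unfolding plane_field_def by blast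
  show "periodic n (\<lambda>i j. reverse_signature (L (a - i) (b - j)))"
    unfolding periodic_def
  proof (intro allI)
    fix i j
    show "reverse_signature (L (a - (i + int n)) (b - (j - int n))) = reverse_signature (L (a - i) (b - j))"
      using per[of "a - (i + int n)" "b - (j - int n)"] by simp
  qed
  fix i j
  show "reverse_signature (L (a - i) (b - j)) \<in> signatures_of_length l" using s by simp
  have "a - (i + 1) + 1 = a - i" "b - (j + 1) + 1 = b - j" by simp_all
  then show "\<exists>c. fomin_square (reverse_signature (L (a - i) (b - j))) (reverse_signature (L (a - (i + 1)) (b - j)))
           (reverse_signature (L (a - i) (b - (j + 1)))) (reverse_signature (L (a - (i + 1)) (b - (j + 1)))) c"
    using fomin_square_reverse[OF plane_field_square(1)[OF assms] s s s s, of "a - (i + 1)" "b - (j + 1)"]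
    by metis
qed

section \<open>Two tableaux determine a field\<close>

lemma periodic_eqI:
  assumes n: "n \<ge> 1" and per: "periodic n f" "periodic n g"
    and eq: "\<And>i j. 0 \<le> i \<Longrightarrow> i < int n \<Longrightarrow> f i j = g i j"
  shows "f i j = g i j"
proof -
  have e: "i + (- (i div int n)) * int n = i mod int n" by (simp add: minus_div_mult_eq_mod [symmetric])
  have "f (i mod int n) (j - (- (i div int n)) * int n) = g (i mod int n) (j - (- (i div int n)) * int n)"
    using n by (intro eq) simp_all
  then show ?thesis
    using periodic_mult[OF per(1), of i "- (i div int n)" j] periodic_mult[OF per(2), of i "- (i div int n)" j]
    unfolding e by simp
qed

text \<open>The strip \<open>0 \<le> i \<le> n\<close> is filled row by row, and each row from left
  to right, by the local rule.\<close>

lemma plane_field_unique_upper: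
  assumes n: "n \<ge> 1" and L: "plane_field n l L" "plane_field n l L'"
    and eq: "\<And>i. i \<le> n \<Longrightarrow> L (int i) 0 = L' (int i) 0" "\<And>i. i \<le> n \<Longrightarrow> L 0 (int i) = L' 0 (int i)"
  shows "i \<le> n \<Longrightarrow> L (int i) (int s) = L' (int i) (int s)"
proof (induction s arbitrary: i rule: less_induct)
  case (less s)
  show ?case
  proof (cases "s = 0")
    case True then show ?thesis using eq less.prems by simp
  next
    case False
    then obtain s' where s: "s = Suc s'" using not0_implies_Suc by blast
    from less.prems show ?thesis
    proof (induction i)
      case 0
      show ?case
      proof (cases "s \<le> n")
        case True then show ?thesis using eq by simp
      next
        \<comment> \<open>Above row \<open>n\<close> the left edge is glued to the right edge
          \<open>n\<close> rows lower, which the outer induction covers.\<close>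
        case False
        have per: "L (0 + int n) (int s - int n) = L 0 (int s)" "L' (0 + int n) (int s - int n) = L' 0 (int s)"
          using L unfolding plane_field_def periodic_def by blast+
        have "L (int n) (int (s - n)) = L' (int n) (int (s - n))" using False n by (intro less.IH) auto
        moreover have "int (s - n) = int s - int n" using False by simp
        ultimately show ?thesis using per by simp
      qed
    next
      case (Suc i)
      have "L (int i) (int s) = L' (int i) (int s)" using Suc by simp
      moreover have "L (int i) (int s') = L' (int i) (int s')" "L (int (Suc i)) (int s') = L' (int (Suc i)) (int s')"
        using less.IH[of s' i] less.IH[of s' "Suc i"] s Suc.prems by (simp_all del: of_nat_Suc)
      moreover have "int i + 1 = int (Suc i)" "int s' + 1 = int s" using s by simp_all
      ultimately show ?case
        using plane_field_square(2)[OF L(1), of "int i" "int s'"] plane_field_square(2)[OF L(2), of "int i" "int s'"]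
        by metis
    qed
  qed
qed

lemma plane_field_unique:
  assumes n: "n \<ge> 1" and L: "plane_field n l L" "plane_field n l L'"
    and eq: "\<And>i. i \<le> n \<Longrightarrow> L (int i) 0 = L' (int i) 0" "\<And>i. i \<le> n \<Longrightarrow> L 0 (int i) = L' 0 (int i)"
  shows "L i j = L' i j"
proof (rule periodic_eqI[OF n])
  show per: "periodic n L" "periodic n L'" using L unfolding plane_field_def by blast+
  fix i j :: int assume i: "0 \<le> i" "i < int n"
  show "L i j = L' i j"
  proof (cases "0 \<le> j")
    case True
    then show ?thesis using plane_field_unique_upper[OF n L eq, of "nat i" "nat j"] i by simp
  next
    case False
    \<comment> \<open>The reflection \<open>i \<mapsto> n - i\<close>,
      \<open>j \<mapsto> - j\<close> moves the negative rows of the strip to the upper half.\<close>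
    let ?r = "\<lambda>L i j. reverse_signature (L (int n - i) (0 - j))"
    have "?r L (int (nat (int n - i))) (int (nat (- j))) = ?r L' (int (nat (int n - i))) (int (nat (- j)))"
    proof (rule plane_field_unique_upper[OF n plane_field_reverse[OF L(1)] plane_field_reverse[OF L(2)]])
      fix k assume k: "k \<le> n"
      then have e: "int n - int k = int (n - k)" by simp
      show "?r L (int k) 0 = ?r L' (int k) 0" using eq(1)[of "n - k"] unfolding e by simp
      \<comment> \<open>The reflected left edge consists of the vertices \<open>(n, - k)\<close>,
        which are glued to \<open>(0, n - k)\<close> on the given left edge.\<close>
      have "L (0 + int n) (int (n - k) - int n) = L' (0 + int n) (int (n - k) - int n)"
      proof -
        have "L (0 + int n) (int (n - k) - int n) = L 0 (int (n - k))"
          "L' (0 + int n) (int (n - k) - int n) = L' 0 (int (n - k))"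
          using per unfolding periodic_def by blast+
        then show ?thesis using eq(2)[of "n - k"] by simp
      qed
      then show "?r L 0 (int k) = ?r L' 0 (int k)" using k by (simp add: e [symmetric])
    qed (use i in simp)
    then have "reverse_signature (L i j) = reverse_signature (L' i j)" using i False by simp
    then show ?thesis by (metis reverse_reverse)
  qed
qed

text \<open>Growth in the strip \<open>0 \<le> i \<le> n\<close> over the nonnegative rows, with the
  left edge continued by gluing it to the right one. The guard \<open>n = 0\<close> ensures
  \<open>j - n < j\<close> in the recursive call.\<close>

function grow :: "nat \<Rightarrow> int list list \<Rightarrow> int list list \<Rightarrow> nat \<Rightarrow> nat \<Rightarrow> int list" where
  "grow n P Q i j =
     (if n = 0 \<or> j = 0 then P ! i
      else if i = 0 then (if j \<le> n then Q ! j else grow n P Q n (j - n))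
      else fomin_rule (grow n P Q (i - 1) (j - 1)) (grow n P Q i (j - 1)) (grow n P Q (i - 1) j))"
  by pat_completeness auto
termination by (relation "measures [\<lambda>(n, P, Q, i, j). j, \<lambda>(n, P, Q, i, j). i]") auto

declare grow.simps [simp del]

definition tableau_pair :: "nat \<Rightarrow> nat \<Rightarrow> int list list \<Rightarrow> int list list \<Rightarrow> bool" where
  "tableau_pair n l P Q \<longleftrightarrow> length P = n + 1 \<and> length Q = n + 1
     \<and> set P \<subseteq> signatures_of_length l \<and> set Q \<subseteq> signatures_of_length l
     \<and> (\<forall>i<n. P ! i \<preceq> P ! Suc i) \<and> (\<forall>i<n. Q ! i \<preceq> Q ! Suc i)
     \<and> P ! 0 = Q ! 0 \<and> P ! n = Q ! n"

context
  fixes n l P Q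
  assumes n: "n \<ge> 1" and PQ: "tableau_pair n l P Q"
begin

lemma grow_bottom: "grow n P Q i 0 = P ! i"
  by (subst grow.simps) simp

lemma grow_left: "j \<le> n \<Longrightarrow> grow n P Q 0 j = Q ! j"
  using PQ by (subst grow.simps) (auto simp: tableau_pair_def)

lemma grow_wrap: "grow n P Q 0 (j + n) = grow n P Q n j"
proof (cases "j = 0")
  case True
  then show ?thesis using PQ n by (simp add: grow_bottom grow_left tableau_pair_def)
next
  case False
  then show ?thesis using n by (subst grow.simps) simp
qed

lemma grow_Suc: "grow n P Q (Suc i) (Suc j) =
  fomin_rule (grow n P Q i j) (grow n P Q (Suc i) j) (grow n P Q i (Suc j))"
  using n by (subst grow.simps) simp

text \<open>Membership and interlacing are proved together because \<open>fomin_square_rule\<close>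
  passes to the next signature only from both. On the left edge above row \<open>n\<close> they are
  inherited through \<open>grow_wrap\<close>.\<close>

lemma grow_props:
  "i \<le> n \<Longrightarrow> grow n P Q i j \<in> signatures_of_length l
     \<and> (0 < i \<longrightarrow> grow n P Q (i - 1) j \<preceq> grow n P Q i j)
     \<and> (0 < j \<longrightarrow> grow n P Q i (j - 1) \<preceq> grow n P Q i j)"
proof (induction j arbitrary: i rule: less_induct)
  case (less j)
  have inP: "P ! i \<in> signatures_of_length l" "Q ! i \<in> signatures_of_length l" if "i \<le> n" for i
    using PQ that nth_mem[of i P] nth_mem[of i Q] unfolding tableau_pair_def by auto
  have PS: "P ! i \<preceq> P ! Suc i" "Q ! i \<preceq> Q ! Suc i" if "i < n" for i
    using PQ that unfolding tableau_pair_def by auto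
  show ?case
  proof (cases j)
    case 0
    then show ?thesis using inP(1)[OF less.prems] PS(1)[of "i - 1"] less.prems
      by (cases i) (auto simp: grow_bottom)
  next
    case (Suc j')
    from less.prems show ?thesis
    proof (induction i)
      case 0
      show ?case
      proof (cases "j \<le> n")
        case True
        then show ?thesis using inP(2)[of j] PS(2)[of j'] Suc by (simp add: grow_left)
      next
        case False
        define k where "k = j - n"
        have k: "j = k + n" "0 < k" "j - 1 = (k - 1) + n" "k < j" using False n unfolding k_def by auto
        have "grow n P Q 0 j = grow n P Q n k" "grow n P Q 0 (j - 1) = grow n P Q n (k - 1)"
          unfolding k(3) using grow_wrap k(1) by simp_all
        then show ?thesis using less.IH[of k n] k by simp
      qed
    next
      case (Suc i)
      note j = \<open>j = Suc j'\<close>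
      have 1: "grow n P Q i j \<in> signatures_of_length l" "grow n P Q i j' \<preceq> grow n P Q i j"
        using Suc j by simp_all
      have 2: "grow n P Q (Suc i) j' \<in> signatures_of_length l" "grow n P Q i j' \<preceq> grow n P Q (Suc i) j'"
        "grow n P Q i j' \<in> signatures_of_length l"
        using less.IH[of j' "Suc i"] less.IH[of j' i] Suc.prems j by auto
      note r = fomin_square_rule[OF 2(3,1) 1(1) 2(2) 1(2)]
      have e: "grow n P Q (Suc i) j = fomin_rule (grow n P Q i j') (grow n P Q (Suc i) j') (grow n P Q i j)"
        unfolding j by (rule grow_Suc)
      show ?case using r(1) fomin_square_interlaces(3,4)[OF r(2) 2(3,1) 1(1) r(1)] j unfolding e [symmetric] by simp
    qed
  qed
qed

lemma grow_square:
  assumes "i < n"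
  shows "\<exists>c. fomin_square (grow n P Q i j) (grow n P Q (Suc i) j) (grow n P Q i (Suc j)) (grow n P Q (Suc i) (Suc j)) c"
proof -
  have "grow n P Q i j \<in> signatures_of_length l" "grow n P Q (Suc i) j \<in> signatures_of_length l"
    "grow n P Q i (Suc j) \<in> signatures_of_length l" "grow n P Q i j \<preceq> grow n P Q (Suc i) j"
    "grow n P Q i j \<preceq> grow n P Q i (Suc j)"
    using grow_props[of i j] grow_props[of "Suc i" j] grow_props[of i "Suc j"] assms by auto
  from fomin_square_rule(2)[OF this] show ?thesis unfolding grow_Suc by blast
qed

end

section \<open>Reversed tableaux and existence of fields\<close>

definition reverse_tableau :: "int list list \<Rightarrow> int list list" where
  "reverse_tableau P = rev (map reverse_signature P)"

lemma reverse_tableau_nth: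
  "length P = n + 1 \<Longrightarrow> i \<le> n \<Longrightarrow> reverse_tableau P ! i = reverse_signature (P ! (n - i))"
  by (simp add: reverse_tableau_def rev_nth)

lemma interlaces_reverse: "kap \<preceq> mu \<Longrightarrow> reverse_signature mu \<preceq> reverse_signature kap"
  unfolding interlaces_def
proof (intro conjI allI impI)
  assume a: "length kap = length mu \<and> (\<forall>i<length mu. kap ! i \<le> mu ! i) \<and>
    (\<forall>i. Suc i < length mu \<longrightarrow> mu ! Suc i \<le> kap ! i)"
  then have len: "length kap = length mu" by blast
  then show "length (reverse_signature mu) = length (reverse_signature kap)" by (simp add: reverse_signature_def)
  fix i
  show "reverse_signature mu ! i \<le> reverse_signature kap ! i" if "i < length (reverse_signature kap)"
    using that a by (simp add: reverse_signature_def rev_nth)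
  show "reverse_signature kap ! Suc i \<le> reverse_signature mu ! i" if "Suc i < length (reverse_signature kap)"
  proof -
    have "length mu - Suc i = Suc (length mu - Suc (Suc i))" "length mu - Suc i < length mu"
      using that len by (auto simp: reverse_signature_def)
    then have "mu ! (length mu - Suc i) \<le> kap ! (length mu - Suc (Suc i))" using a by metis
    then show ?thesis using that len by (simp add: reverse_signature_def rev_nth)
  qed
qed

lemma tableau_pair_reverse:
  assumes "tableau_pair n l P Q"
  shows "tableau_pair n l (reverse_tableau P) (reverse_tableau Q)"
proof -
  have len: "length P = n + 1" "length Q = n + 1" using assms unfolding tableau_pair_def by auto
  have i: "reverse_tableau R ! i \<preceq> reverse_tableau R ! Suc i"
    if "length R = n + 1" "\<forall>i<n. R ! i \<preceq> R ! Suc i" "i < n" for R i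
  proof -
    have "R ! (n - Suc i) \<preceq> R ! Suc (n - Suc i)" using that by simp
    moreover have "Suc (n - Suc i) = n - i" using that(3) by simp
    ultimately show ?thesis
      using that reverse_tableau_nth[OF that(1), of i] reverse_tableau_nth[OF that(1), of "Suc i"]
        interlaces_reverse by simp
  qed
  show ?thesis
    unfolding tableau_pair_def
  proof (intro conjI)
    show "\<forall>i<n. reverse_tableau P ! i \<preceq> reverse_tableau P ! Suc i"
      "\<forall>i<n. reverse_tableau Q ! i \<preceq> reverse_tableau Q ! Suc i"
      using i assms unfolding tableau_pair_def by blast+
    show "reverse_tableau P ! 0 = reverse_tableau Q ! 0" "reverse_tableau P ! n = reverse_tableau Q ! n"
      using assms len by (simp_all add: reverse_tableau_nth tableau_pair_def)
  qed (use assms in \<open>auto simp: tableau_pair_def reverse_tableau_def\<close>)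
qed

lemma plane_field_exists:
  assumes n: "n \<ge> 1" and PQ: "tableau_pair n l P Q"
  shows "\<exists>L. plane_field n l L \<and> (\<forall>i \<le> n. L (int i) 0 = P ! i \<and> L 0 (int i) = Q ! i)"
proof -
  let ?P = "reverse_tableau P" and ?Q = "reverse_tableau Q"
  note PQ' = tableau_pair_reverse[OF PQ]
  have len: "length P = n + 1" "length Q = n + 1" using PQ unfolding tableau_pair_def by auto
  \<comment> \<open>The strip \<open>0 \<le> i \<le> n\<close> is a fundamental domain with \<open>(n, s)\<close> glued to \<open>(0, s + n)\<close>. Its lower
    half is grown from the time-reversed tableaux.\<close>
  define S where "S i s = (if s \<ge> 0 then grow n P Q i (nat s)
      else reverse_signature (grow n ?P ?Q (n - i) (nat (- s))))" for i and s :: int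
  \<comment> \<open>The halves agree in row \<open>0\<close>, so the lower formula also covers
    squares whose upper side lies in that row.\<close>
  have S0: "S i s = reverse_signature (grow n ?P ?Q (n - i) (nat (- s)))" if "s \<le> 0" "i \<le> n" for i s
    using that by (cases "s = 0")
      (auto simp: S_def grow_bottom[OF n PQ] grow_bottom[OF n PQ'] reverse_tableau_nth[OF len(1)])
  have Ssig: "S i s \<in> signatures_of_length l" if "i \<le> n" for i s
    unfolding S_def using grow_props[OF n PQ that] grow_props[OF n PQ', of "n - i"] by simp
  \<comment> \<open>In the middle case the gluing crosses row \<open>0\<close>: both sides are the
    same entry of \<open>Q\<close>, one of them reached through the reversed tableau.\<close>
  have wrap: "S n s = S 0 (s + int n)" for s
  proof -
    consider "s \<ge> 0" | "- int n \<le> s" "s < 0" | "s < - int n" by linarith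
    then show ?thesis
    proof cases
      case 1
      then have "nat (s + int n) = nat s + n" by simp
      then show ?thesis using 1 grow_wrap[OF n PQ, of "nat s"] by (simp add: S_def)
    next
      case 2
      then have e: "nat (- s) \<le> n" "nat (s + int n) = n - nat (- s)" by auto
      have "S n s = reverse_signature (?Q ! nat (- s))"
        using 2 e(1) by (simp add: S_def grow_left[OF n PQ'])
      also have "\<dots> = Q ! (n - nat (- s))" using e by (simp add: reverse_tableau_nth[OF len(2)])
      also have "\<dots> = S 0 (s + int n)" using 2 e by (simp add: S_def grow_left[OF n PQ])
      finally show ?thesis .
    next
      case 3
      then have e: "nat (- s) = nat (- (s + int n)) + n" by simp
      show ?thesis using 3 grow_wrap[OF n PQ', of "nat (- (s + int n))"] by (simp add: S_def e)
    qed
  qed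
  have square: "\<exists>c. fomin_square (S i s) (S (Suc i) s) (S i (s + 1)) (S (Suc i) (s + 1)) c" if i: "i < n" for i s
  proof (cases "s \<ge> 0")
    case True
    then have "nat (s + 1) = Suc (nat s)" by simp
    then show ?thesis using grow_square[OF n PQ i, of "nat s"] True by (simp add: S_def)
  next
    case False
    define j where "j = nat (- (s + 1))"
    define k where "k = n - Suc i"
    let ?G = "grow n ?P ?Q"
    have k: "k < n" "n - i = Suc k" "n - Suc i = k" using i unfolding k_def by auto
    have j: "nat (- s) = Suc j" "nat (- (s + 1)) = j" using False unfolding j_def by auto
    obtain c where c: "fomin_square (?G k j) (?G (Suc k) j) (?G k (Suc j)) (?G (Suc k) (Suc j)) c"
      using grow_square[OF n PQ' k(1)] by blast
    have sig: "?G k j' \<in> signatures_of_length l" "?G (Suc k) j' \<in> signatures_of_length l" for j'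
      using grow_props[OF n PQ', of k j'] grow_props[OF n PQ', of "Suc k" j'] k(1) by auto
    note fomin_square_reverse[OF c sig(1,2,1,2)]
    moreover have "S i s = reverse_signature (?G (Suc k) (Suc j))" "S (Suc i) s = reverse_signature (?G k (Suc j))"
      "S i (s + 1) = reverse_signature (?G (Suc k) j)" "S (Suc i) (s + 1) = reverse_signature (?G k j)"
      using S0[of s i] S0[of s "Suc i"] S0[of "s + 1" i] S0[of "s + 1" "Suc i"] False i unfolding k j by auto
    ultimately show ?thesis by metis
  qed
  \<comment> \<open>\<open>i div n\<close> counts the translations that bring the vertex back to the
    strip.\<close>
  define L where "L i j = S (nat (i mod int n)) (j + (i div int n) * int n)" for i j
  have "plane_field n l L"
    unfolding plane_field_def
  proof (intro conjI allI)
    show "periodic n L" unfolding periodic_def L_def using n by (simp add: algebra_simps)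
    fix i j
    have m: "0 \<le> i mod int n" "i mod int n < int n" using n by simp_all
    show "L i j \<in> signatures_of_length l" unfolding L_def
      using m by (intro Ssig) linarith
    define r where "r = nat (i mod int n)"
    define s where "s = j + (i div int n) * int n"
    have r: "r < n" "i mod int n = int r" using m unfolding r_def by (linarith, simp)
    have i: "i = (i div int n) * int n + int r" using r(2) by (metis div_mult_mod_eq)
    have "L (i + 1) j' = S (Suc r) (j' + (i div int n) * int n)" for j'
    proof (cases "Suc r < n")
      case True
      have "i + 1 = int (Suc r) + (i div int n) * int n" using i by simp
      then have "(i + 1) div int n = i div int n" "(i + 1) mod int n = int (Suc r)"
        using True by (simp_all only: div_mult_self1 mod_mult_self1) simp_all
      then show ?thesis unfolding L_def by (simp del: of_nat_Suc)
    next
      \<comment> \<open>Here the square touches the seam: \<open>wrap\<close> trades the edge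
        \<open>n\<close> for the edge \<open>0\<close>, \<open>n\<close> rows higher.\<close>
      case False
      then have "Suc r = n" using r(1) by simp
      then have e: "i + 1 = 0 + (i div int n + 1) * int n" using i by (simp add: algebra_simps)
      have "int n \<noteq> 0" using n by simp
      from div_mult_self1[OF this, of 0 "i div int n + 1"] have "(i + 1) div int n = i div int n + 1"
        unfolding e [symmetric] by simp
      moreover have "(i + 1) mod int n = 0"
        using mod_mult_self1[of 0 "i div int n + 1" "int n"] unfolding e [symmetric] by simp
      ultimately show ?thesis using wrap \<open>Suc r = n\<close> unfolding L_def by (simp add: algebra_simps)
    qed
    moreover have "L i j' = S r (j' + (i div int n) * int n)" for j' unfolding L_def r_def ..
    moreover have "j + 1 + (i div int n) * int n = s + 1" unfolding s_def by simp
    ultimately show "\<exists>c. fomin_square (L i j) (L (i + 1) j) (L i (j + 1)) (L (i + 1) (j + 1)) c"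
      using square[OF r(1), of s] by (simp only: s_def [symmetric])
  qed
  moreover have "L (int i) 0 = P ! i \<and> L 0 (int i) = Q ! i" if "i \<le> n" for i
  proof
    show "L 0 (int i) = Q ! i" using that by (simp add: L_def S_def grow_left[OF n PQ])
    show "L (int i) 0 = P ! i"
    proof (cases "i = n")
      case True
      then show ?thesis using n PQ by (simp add: L_def S_def grow_left[OF n PQ] tableau_pair_def)
    next
      case False
      then show ?thesis using that by (simp add: L_def S_def grow_bottom[OF n PQ])
    qed
  qed
  ultimately show ?thesis by blast
qed

section \<open>Fields and sequences of columns\<close>

definition height :: "(int \<Rightarrow> int \<Rightarrow> int list) \<Rightarrow> int \<Rightarrow> int \<Rightarrow> int \<Rightarrow> int" where
  "height L x i j = int (conjugate (L i j) x)"

definition load :: "(int \<Rightarrow> int \<Rightarrow> int list) \<Rightarrow> int \<Rightarrow> int \<Rightarrow> int \<Rightarrow> nat" where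
  "load L x i j = carrier_load (L i j) (L (i + 1) j) (L i (j + 1)) x"

lemma plane_field_signature: "plane_field n l L \<Longrightarrow> L i j \<in> signatures_of_length l"
  unfolding plane_field_def by blast

lemma field_column:
  assumes "plane_field n l L"
  shows "column (height L x) (load L (x - 1)) (load L x)"
  unfolding column_def height_def load_def
  using plane_field_square(1)[OF assms] unfolding fomin_square_def by blast

lemma field_transit:
  assumes n: "n \<ge> 1" and L: "plane_field n l L"
  shows "\<exists>a b. transit (height L x) a b"
proof (rule transit_of_bounded[OF n])
  show "periodic n (height L x)" using L unfolding plane_field_def periodic_def height_def by simp
  show "height L x i j \<le> height L x i' j'" if "i \<le> i'" "j \<le> j'" for i j i' j'
    using column_mono[OF field_column[OF L] that] .
  show "0 \<le> height L x i j" "height L x i j \<le> int l" for i j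
    unfolding height_def using conjugate_le_length[OF plane_field_signature[OF L]] by simp_all
qed

lemma field_load:
  assumes n: "n \<ge> 1" and L: "plane_field n l L"
  shows "periodic n (load L x)" "level_bounded (load L x)"
proof -
  have "L (i + int n) (j - int n) = L i j" for i j using L unfolding plane_field_def periodic_def by blast
  from this[of "i" j for i j] this[of "i + 1" j for i j] this[of i "j + 1" for i j]
  show "periodic n (load L x)"
    unfolding periodic_def load_def by (simp add: algebra_simps)
  obtain a b where "transit (height L x) a b" using field_transit[OF n L] by blast
  then show "level_bounded (load L x)" using column_level_bounded(2)[OF field_column[OF L]] by blast
qed

text \<open>Along the row \<open>j = 0\<close> the level tends to -\<infinity>, so for every
  \<open>x\<close> the conjugates of \<open>L t 0\<close> at \<open>x\<close> are eventually equal
  to the past height.\<close>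

lemma field_limit:
  assumes n: "n \<ge> 1" and L: "plane_field n l L"
  defines "nu \<equiv> limit_signature l (\<lambda>t. L t 0)"
  shows "nu \<in> signatures" "\<exists>b. transit (height L x) (int (conjugate nu x)) b"
proof -
  obtain a b where ab: "\<And>x. transit (height L x) (a x) (b x)" using field_transit[OF n L] by metis
  note bnd = transit_column_bounds(1)[OF field_column[OF L] ab]
  have lim: "\<exists>T. \<forall>t\<le>T. height L x t 0 = a x" for x
  proof -
    obtain B where "\<And>i j. i + j \<le> - B \<Longrightarrow> height L x i j = a x" using ab[of x] unfolding transit_def by blast
    then have "\<forall>t\<le>- B. height L x t 0 = a x" by simp
    then show ?thesis by blast
  qed
  have a0: "0 \<le> a x" for x using lim[of x] by (auto simp: height_def)
  \<comment> \<open>The past height at this \<open>Y\<close> is at most the height at the origin,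
    hence \<open>0\<close>, as \<open>limit_signature_conjugate\<close> requires for one
    argument.\<close>
  obtain Y where Y: "conjugate (L 0 0) Y = 0" using conjugate_top by blast
  have "\<exists>T. \<forall>t\<le>T. conjugate (L t 0) x = nat (a x)" for x
    using lim[of x] by (force simp: height_def)
  moreover have "nat (a Y) = 0" using bnd[of Y 0 0] Y by (simp add: height_def)
  ultimately have "nu \<in> signatures" "conjugate nu = (\<lambda>x. nat (a x))"
    using limit_signature_conjugate[OF plane_field_signature[OF L], of "\<lambda>t. t" "\<lambda>t. 0" "\<lambda>x. nat (a x)"]
    unfolding nu_def by blast+
  then show "nu \<in> signatures" "\<exists>b. transit (height L x) (int (conjugate nu x)) b"
    using ab[of x] a0[of x] by auto
qed

text \<open>The past heights are the conjugate of the common limit. From the load at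
  \<open>0\<close>, uniqueness of columns carries equality to the right and its reversed form to the
  left. The lengths \<open>l\<close> and \<open>l'\<close> may differ a priori; equal conjugates
  settle this.\<close>

lemma field_determined:
  assumes n: "n \<ge> 1" and L: "plane_field n l L" and L': "plane_field n l' L'"
    and c: "load L 0 = load L' 0"
    and nu: "limit_signature l (\<lambda>t. L t 0) = limit_signature l' (\<lambda>t. L' t 0)"
  shows "L = L'"
proof -
  let ?nu = "limit_signature l (\<lambda>t. L t 0)"
  obtain b where b: "\<And>x. transit (height L x) (int (conjugate ?nu x)) (b x)" using field_limit(2)[OF n L] by metis
  obtain b' where b': "\<And>x. transit (height L' x) (int (conjugate ?nu x)) (b' x)"
    using field_limit(2)[OF n L'] unfolding nu by metis
  note col = field_column[OF L] and col' = field_column[OF L']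
  have load: "load L x = load L' x" for x
  proof (induction x rule: int_induct[where k = 0])
    case base show ?case by (rule c)
  next
    case (step1 x)
    have "column (height L (x + 1)) (load L x) (load L (x + 1))"
      "column (height L' (x + 1)) (load L x) (load L' (x + 1))"
      using col[of "x + 1"] col'[of "x + 1"] step1(2) by simp_all
    from column_unique_transit(2)[OF this b b'] show ?case .
  next
    case (step2 x)
    have "column (height L x) (load L (x - 1)) (load L x)"
      "column (height L' x) (load L' (x - 1)) (load L x)"
      using col[of x] col'[of x] step2(2) by simp_all
    from column_unique_transit_back(2)[OF this b b'] show ?case .
  qed
  have "height L x = height L' x" for x
  proof -
    have "column (height L' x) (load L (x - 1)) (load L' x)" using col'[of x] load by simp
    from column_unique_transit(1)[OF col this b b'] show ?thesis .
  qed
  then have "int (conjugate (L i j) x) = int (conjugate (L' i j) x)" for i j x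
    unfolding height_def fun_eq_iff by blast
  then have "conjugate (L i j) = conjugate (L' i j)" for i j by (simp add: fun_eq_iff)
  then have "L i j = L' i j" for i j
    using conjugate_inj[OF plane_field_signature[OF L] plane_field_signature[OF L']] by blast
  then show ?thesis by (simp add: fun_eq_iff)
qed

text \<open>The sequence of columns through \<open>c0\<close>, raised by the conjugate of
  \<open>nu\<close>, consists of the conjugates of a field.\<close>

lemma field_realizes:
  assumes n: "n \<ge> 1" and per: "periodic n c0" and lb: "level_bounded c0" and nu: "nu \<in> signatures"
  shows "\<exists>l L. plane_field n l L \<and> load L 0 = c0 \<and> limit_signature l (\<lambda>t. L t 0) = nu"
proof -
  obtain c :: "int \<Rightarrow> int \<Rightarrow> int \<Rightarrow> nat" and h H where c0: "c 0 = c0"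
    and col: "\<And>x. column (h x) (c (x - 1)) (c x)" and tr: "\<And>x. transit (h x) 0 H"
    and perh: "\<And>x. periodic n (h x)"
    using column_sequence_exists[OF n per lb] by blast
  note bd = transit_column_bounds[OF col tr]
  define m where "m = length nu"
  have num: "nu \<in> signatures_of_length m" using nu unfolding m_def signatures_def signatures_of_length_def by auto
  obtain X0 where X0: "\<And>x. x \<le> X0 \<Longrightarrow> conjugate nu x = m" using conjugate_bot unfolding m_def by blast
  obtain Y0 where Y0: "\<And>x. x \<ge> Y0 \<Longrightarrow> conjugate nu x = 0" using conjugate_top by blast
  \<comment> \<open>Far to the left the conjugate of \<open>nu\<close> is \<open>m\<close> and the
    columns are saturated at \<open>H\<close>, which fixes the common length.\<close>
  define l where "l = m + nat H"
  define f where "f i j x = conjugate nu x + nat (h x i j)" for i j x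
  have fint: "int (f i j x) = h x i j + int (conjugate nu x)" for i j x
    unfolding f_def using bd(1)[of x i j] by simp
  have "\<exists>lam \<in> signatures_of_length l. conjugate lam = f i j" for i j
  proof -
    obtain X where X: "\<And>x. x \<le> X \<Longrightarrow> h x i j = H"
      using column_sequence_saturates[of h c, OF col tr] by blast
    obtain Y where Y: "\<And>x. x \<ge> Y \<Longrightarrow> h x i j = 0"
      using column_sequence_vanishes[of h c, OF col tr] by blast
    show ?thesis
    proof (rule signature_of_conjugate[of "f i j" "min X X0" l "max Y Y0"])
      show "f i j (x + 1) \<le> f i j x" for x
        using conjugate_antimono[of x "x + 1" nu] column_sequence_mono[of h c, OF col tr, of x "x + 1" i j]
        unfolding f_def by simp
      show "f i j x = l" if "x \<le> min X X0" for x using that X X0 unfolding f_def l_def by simp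
      show "f i j (max Y Y0) = 0" using Y Y0 unfolding f_def by simp
    qed
  qed
  then obtain L where L: "\<And>i j. L i j \<in> signatures_of_length l" "\<And>i j. conjugate (L i j) = f i j"
    by metis
  have square: "fomin_square (L i j) (L (i + 1) j) (L i (j + 1)) (L (i + 1) (j + 1)) (\<lambda>x. c x i j)" for i j
  proof -
    have "\<exists>X. \<forall>x\<le>X. h x i' j' = H" for i' j'
      using column_sequence_saturates[of h c, OF col tr] .
    then obtain Z where Z: "\<And>i' j' x. x \<le> Z i' j' \<Longrightarrow> h x i' j' = H" by metis
    \<comment> \<open>Up to \<open>?X\<close> all four corners are saturated, so
      \<open>box_const\<close> makes the load vanish.\<close>
    let ?X = "min (min (Z i j) (Z (i + 1) j)) (min (Z i (j + 1)) (Z (i + 1) (j + 1)))"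
    have "c x i j = 0" if "x \<le> ?X" for x
    proof -
      have "h x i j = H" "h x (i + 1) j = H" "h x i (j + 1) = H" "h x (i + 1) (j + 1) = H"
        using that by (auto intro!: Z)
      then show ?thesis using columnD[OF col, of x i j] by (simp add: box_const)
    qed
    moreover have "box (conjugate (L i j) x) (conjugate (L (i + 1) j) x) (conjugate (L i (j + 1)) x)
        (conjugate (L (i + 1) (j + 1)) x) (c (x - 1) i j) (c x i j)" for x
      unfolding L(2) fint box_add by (rule columnD[OF col])
    ultimately show ?thesis unfolding fomin_square_def by blast
  qed
  have "periodic n L"
    unfolding periodic_def
  proof (intro allI)
    fix i j
    have "f (i + int n) (j - int n) = f i j" unfolding f_def using perh by (simp add: periodic_def)
    then show "L (i + int n) (j - int n) = L i j" using conjugate_inj[OF L(1) L(1)] L(2) by metis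
  qed
  then have pf: "plane_field n l L" unfolding plane_field_def using L(1) square by blast
  have "load L 0 i j = c0 i j" for i j
    unfolding load_def using fomin_square_unique(1)[OF square L(1) signature_length[OF L(1)], of i j] c0 by simp
  then have "load L 0 = c0" by (simp add: fun_eq_iff)
  moreover have "limit_signature l (\<lambda>t. L t 0) = nu"
  proof -
    have "\<exists>T. \<forall>t\<le>T. conjugate (L t 0) x = conjugate nu x" for x
    proof -
      obtain B where B: "\<And>i j. i + j \<le> - B \<Longrightarrow> h x i j = 0" using tr[of x] unfolding transit_def by blast
      have "\<forall>t\<le>- B. conjugate (L t 0) x = conjugate nu x" unfolding L(2) f_def using B by simp
      then show ?thesis by blast
    qed
    from limit_signature_conjugate[of "\<lambda>t. L t 0", OF L(1) this Y0[OF order_refl]]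
    show ?thesis using conjugate_inj num unfolding signatures_def by blast
  qed
  ultimately show ?thesis using pf by blast
qed

section \<open>The cylinder\<close>

lemma equiv_cyl_rel: "equiv UNIV (cyl_rel n :: (('a::ring_1 \<times> 'a) \<times> ('a \<times> 'a)) set)"
proof (rule equivI)
  show "refl (cyl_rel n :: (('a \<times> 'a) \<times> ('a \<times> 'a)) set)"
    unfolding refl_on_def cyl_rel_def by (auto intro!: exI[of _ 0])
  show "sym (cyl_rel n :: (('a \<times> 'a) \<times> ('a \<times> 'a)) set)"
  proof (rule symI)
    fix p q :: "'a \<times> 'a" assume "(p, q) \<in> cyl_rel n"
    then obtain x y k where "p = (x, y)" "q = (x + of_int (k * int n), y - of_int (k * int n))"
      unfolding cyl_rel_def by auto
    then show "(q, p) \<in> cyl_rel n" unfolding cyl_rel_def by (auto intro!: exI[of _ "- k"])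
  qed
  show "trans (cyl_rel n :: (('a \<times> 'a) \<times> ('a \<times> 'a)) set)"
  proof (rule transI)
    fix p q r :: "'a \<times> 'a" assume "(p, q) \<in> cyl_rel n" "(q, r) \<in> cyl_rel n"
    then obtain x y k k' where "p = (x, y)"
      "r = (x + of_int (k * int n) + of_int (k' * int n), y - of_int (k * int n) - of_int (k' * int n))"
      unfolding cyl_rel_def by auto
    then show "(p, r) \<in> cyl_rel n"
      unfolding cyl_rel_def by (auto intro!: exI[of _ "k + k'"] simp: algebra_simps)
  qed
qed simp

lemma vertex_eq_iff: "vertex n i j = vertex n i' j' \<longleftrightarrow> (\<exists>k. i' = i + k * int n \<and> j' = j - k * int n)"
  unfolding vertex_def eq_equiv_class_iff[OF equiv_cyl_rel UNIV_I UNIV_I] by (simp add: cyl_rel_def)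

lemma face_eq_iff: "face n i j = face n i' j' \<longleftrightarrow> (\<exists>k. i' = i + k * int n \<and> j' = j - k * int n)"
proof -
  have "(of_int i' + 1/2 :: rat) = of_int i + 1/2 + of_int (k * int n) \<longleftrightarrow> i' = i + k * int n" for k
  proof -
    have "(of_int i' + 1/2 :: rat) = of_int i + 1/2 + of_int (k * int n)
        \<longleftrightarrow> (of_int i' :: rat) = of_int (i + k * int n)" by auto
    then show ?thesis by (simp only: of_int_eq_iff)
  qed
  moreover have "(of_int j' + 1/2 :: rat) = of_int j + 1/2 - of_int (k * int n) \<longleftrightarrow> j' = j - k * int n" for k
  proof -
    have "(of_int j' + 1/2 :: rat) = of_int j + 1/2 - of_int (k * int n)
        \<longleftrightarrow> (of_int j' :: rat) = of_int (j - k * int n)" by auto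
    then show ?thesis by (simp only: of_int_eq_iff)
  qed
  ultimately show ?thesis
    unfolding face_def eq_equiv_class_iff[OF equiv_cyl_rel UNIV_I UNIV_I] by (simp add: cyl_rel_def)
qed

lemma cylinder_eq: "cylinder n = {vertex n i j |i j. True}"
  unfolding cylinder_def quotient_def vertex_def by auto

lemma cylinder_faces_eq: "cylinder_faces n = {face n i j |i j. True}"
  unfolding cylinder_faces_def quotient_def face_def half_integers_def by auto

text \<open>\<open>d\<close> is the default off the classes: \<open>undefined\<close> for
  extensional fields, \<open>0\<close> for environments.\<close>

lemma lift_to_class:
  assumes "\<And>i j i' j'. g i j = g i' j' \<Longrightarrow> f i j = f i' j'"
  shows "\<exists>F. (\<forall>i j. F (g i j) = f i j) \<and> (\<forall>v. v \<notin> {g i j |i j. True} \<longrightarrow> F v = d)"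
proof -
  have "\<forall>v. \<exists>y. (\<forall>i j. v = g i j \<longrightarrow> y = f i j) \<and> (v \<notin> {g i j |i j. True} \<longrightarrow> y = d)"
  proof
    fix v
    show "\<exists>y. (\<forall>i j. v = g i j \<longrightarrow> y = f i j) \<and> (v \<notin> {g i j |i j. True} \<longrightarrow> y = d)"
    proof (cases "v \<in> {g i j |i j. True}")
      case True
      then obtain i j where "v = g i j" by blast
      have "f i j = f i' j'" if "v = g i' j'" for i' j'
        using trans[OF sym[OF \<open>v = g i j\<close>] that] by (rule assms)
      then show ?thesis using True by blast
    next
      case False
      then show ?thesis by blast
    qed
  qed
  then obtain F where "\<forall>v. (\<forall>i j. v = g i j \<longrightarrow> F v = f i j) \<and> (v \<notin> {g i j |i j. True} \<longrightarrow> F v = d)" by metis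
  then show ?thesis by blast
qed

lemma periodic_class_eq:
  assumes "periodic n f" "\<exists>k. i' = i + k * int n \<and> j' = j - k * int n"
  shows "f i j = f i' j'"
  using assms periodic_mult[OF assms(1)] by auto

lemma periodic_of_class:
  "periodic n (\<lambda>i j. L (vertex n i j))" "periodic n (\<lambda>i j. c (face n i j))"
proof -
  have "vertex n (i + int n) (j - int n) = vertex n i j" for i j
    unfolding vertex_eq_iff by (auto intro!: exI[of _ "- 1"])
  then show "periodic n (\<lambda>i j. L (vertex n i j))" unfolding periodic_def by simp
  have "face n (i + int n) (j - int n) = face n i j" for i j
    unfolding face_eq_iff by (auto intro!: exI[of _ "- 1"])
  then show "periodic n (\<lambda>i j. c (face n i j))" unfolding periodic_def by simp
qed

lemma fomin_fields_iff:
  "L \<in> fomin_fields n l \<longleftrightarrow> L \<in> extensional (cylinder n) \<and> plane_field n l (\<lambda>i j. L (vertex n i j))"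
proof -
  have "L \<in> cylinder n \<rightarrow> signatures_of_length l \<longleftrightarrow> (\<forall>i j. L (vertex n i j) \<in> signatures_of_length l)"
    unfolding cylinder_eq by auto
  then show ?thesis
    unfolding fomin_fields_def plane_field_iff PiE_def using periodic_of_class(1)[of n L] by auto
qed

lemma fomin_fields_eqI:
  assumes "L \<in> fomin_fields n l" "L' \<in> fomin_fields n l'" "\<And>i j. L (vertex n i j) = L' (vertex n i j)"
  shows "L = L'"
proof (rule extensionalityI[of L "cylinder n"])
  show "L \<in> extensional (cylinder n)" "L' \<in> extensional (cylinder n)" using assms(1,2) by (auto simp: fomin_fields_iff)
  show "L v = L' v" if "v \<in> cylinder n" for v using that assms(3) unfolding cylinder_eq by auto
qed

lemma fomin_fields_lift:
  assumes "plane_field n l K"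
  shows "\<exists>L \<in> fomin_fields n l. \<forall>i j. L (vertex n i j) = K i j"
proof -
  have "periodic n K" using assms unfolding plane_field_def by blast
  then have "K i j = K i' j'" if "vertex n i j = vertex n i' j'" for i j i' j'
    using that unfolding vertex_eq_iff by (rule periodic_class_eq)
  from lift_to_class[of "vertex n" K, OF this] obtain L where
    L: "(\<forall>i j. L (vertex n i j) = K i j) \<and> (\<forall>v. v \<notin> cylinder n \<longrightarrow> L v = undefined)"
    unfolding cylinder_eq ..
  then have "L \<in> fomin_fields n l" using assms by (simp add: fomin_fields_iff extensional_def)
  then show ?thesis using L by blast
qed

lemma environment_eq:
  assumes n: "n \<ge> 1" and L: "L \<in> fomin_fields n l"
  shows "environment n L (face n i j) = load (\<lambda>i j. L (vertex n i j)) 0 i j"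
    "F \<notin> cylinder_faces n \<Longrightarrow> environment n L F = 0"
proof -
  let ?K = "\<lambda>i j. L (vertex n i j)"
  have pf: "plane_field n l ?K" using L by (simp add: fomin_fields_iff)
  have "load ?K 0 i j = load ?K 0 i' j'" if "face n i j = face n i' j'" for i j i' j'
    using field_load(1)[OF n pf] that unfolding face_eq_iff by (rule periodic_class_eq)
  from lift_to_class[of "face n" "load ?K 0", OF this] obtain c where
    cc: "(\<forall>i j. c (face n i j) = load ?K 0 i j) \<and> (\<forall>F. F \<notin> cylinder_faces n \<longrightarrow> c F = 0)"
    unfolding cylinder_faces_eq ..
  then have c: "\<And>i j. c (face n i j) = load ?K 0 i j" "\<And>F. F \<notin> cylinder_faces n \<Longrightarrow> c F = 0" by blast+
  have "environment n L = c"
    unfolding environment_def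
  proof (rule the_equality)
    show "(\<forall>F. F \<notin> cylinder_faces n \<longrightarrow> c F = 0) \<and>
      (\<forall>i j. c (face n i j) =
        carrier_load (L (vertex n i j)) (L (vertex n (i + 1) j)) (L (vertex n i (j + 1))) 0)"
      using c by (auto simp: load_def)
    fix c' assume c': "(\<forall>F. F \<notin> cylinder_faces n \<longrightarrow> c' F = 0) \<and>
      (\<forall>i j. c' (face n i j) =
        carrier_load (L (vertex n i j)) (L (vertex n (i + 1) j)) (L (vertex n i (j + 1))) 0)"
    show "c' = c"
    proof
      fix F show "c' F = c F"
        using c c' by (cases "F \<in> cylinder_faces n") (auto simp: cylinder_faces_eq load_def)
    qed
  qed
  then show "environment n L (face n i j) = load ?K 0 i j" "F \<notin> cylinder_faces n \<Longrightarrow> environment n L F = 0"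
    using c by auto
qed

lemma finsupp_functions_iff:
  assumes n: "n \<ge> 1"
  shows "c \<in> finsupp_functions (cylinder_faces n) \<longleftrightarrow>
    (\<forall>F. F \<notin> cylinder_faces n \<longrightarrow> c F = 0) \<and> level_bounded (\<lambda>i j. c (face n i j))"
proof -
  have "level_bounded (\<lambda>i j. c (face n i j))" if fin: "finite {F. c F \<noteq> 0}"
  proof -
    \<comment> \<open>The level descends to faces, so a finite support has bounded levels.\<close>
    have "i + j = i' + j'" if "face n i j = face n i' j'" for i j i' j'
      using that unfolding face_eq_iff by auto
    then obtain lev where lev: "\<And>i j. lev (face n i j) = i + j"
      using lift_to_class[of "face n" "\<lambda>i j. i + j"] by meson
    let ?S = "insert 0 ((\<lambda>F. \<bar>lev F\<bar>) ` {F. c F \<noteq> 0})"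
    have "\<bar>i + j\<bar> \<le> Max ?S" if "c (face n i j) \<noteq> 0" for i j
    proof (rule Max_ge)
      show "finite ?S" using fin by simp
      show "\<bar>i + j\<bar> \<in> ?S" using that lev[of i j] by force
    qed
    then show ?thesis unfolding level_bounded_def by blast
  qed
  moreover have "finite {F. c F \<noteq> 0}"
    if off: "\<forall>F. F \<notin> cylinder_faces n \<longrightarrow> c F = 0" and lb: "level_bounded (\<lambda>i j. c (face n i j))"
  proof -
    obtain B where B: "\<And>i j. c (face n i j) \<noteq> 0 \<Longrightarrow> \<bar>i + j\<bar> \<le> B" using lb unfolding level_bounded_def by blast
    \<comment> \<open>A representative with first coordinate in \<open>{0..<n}\<close> and level
      between \<open>- B\<close> and \<open>B\<close> has its second coordinate in this
      interval.\<close>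
    have "{F. c F \<noteq> 0} \<subseteq> (\<lambda>(i, j). face n i j) ` ({0..<int n} \<times> {- B - int n..B})"
    proof
      fix F assume "F \<in> {F. c F \<noteq> 0}"
      then have F: "c F \<noteq> 0" by simp
      then have "F \<in> cylinder_faces n" using off by auto
      then obtain i j where ij: "F = face n i j" unfolding cylinder_faces_eq by blast
      define i' where "i' = i mod int n"
      define j' where "j' = j + (i div int n) * int n"
      have i'0: "i' = i + (- (i div int n)) * int n" unfolding i'_def by (simp add: minus_div_mult_eq_mod [symmetric])
      then have "face n i j = face n i' j'"
        unfolding face_eq_iff j'_def by (intro exI[of _ "- (i div int n)"]) simp
      moreover have "i' + j' = i + j" using i'0 unfolding j'_def by simp
      moreover have "0 \<le> i'" "i' < int n" using n unfolding i'_def by simp_all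
      ultimately have "F = face n i' j'" "(i', j') \<in> {0..<int n} \<times> {- B - int n..B}"
        using B[of i j] F ij by auto
      then show "F \<in> (\<lambda>(i, j). face n i j) ` ({0..<int n} \<times> {- B - int n..B})" by force
    qed
    then show ?thesis using finite_subset by blast
  qed
  ultimately show ?thesis unfolding finsupp_functions_def by blast
qed

section \<open>The bijection\<close>

text \<open>\<open>SST\<close> asks for signatures of unspecified length; interlacing propagates the
  length of \<open>rho\<close> along the chain.\<close>

lemma tableau_pair_of_SST:
  assumes "rho \<in> signatures" "P \<in> SST lam rho n" "Q \<in> SST lam rho n"
  shows "tableau_pair n (length rho) P Q"
proof -
  have *: "set R \<subseteq> signatures_of_length (length rho)" if R: "R \<in> SST lam rho n" for R
  proof -
    have "R ! i \<in> signatures_of_length (length rho)" if "i \<le> n" for i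
      using that
    proof (induction i)
      case 0
      then show ?case using R assms(1) by (auto simp: SST_def signatures_def signatures_of_length_def)
    next
      case (Suc i)
      then have "R ! i \<preceq> R ! Suc i" "R ! Suc i \<in> signatures" using R nth_mem[of "Suc i" R] by (auto simp: SST_def)
      then show ?case using Suc interlaces_signature by simp
    qed
    then show ?thesis using R by (auto simp: SST_def in_set_conv_nth less_Suc_eq_le)
  qed
  show ?thesis using *[OF assms(2)] *[OF assms(3)] assms(2,3) by (auto simp: tableau_pair_def SST_def)
qed

lemma field_of_tableaux_eq:
  assumes n: "n \<ge> 1" and L: "L \<in> fomin_fields n (length (P ! 0))"
    and PQ: "\<And>i. i \<le> n \<Longrightarrow> L (vertex n (int i) 0) = P ! i \<and> L (vertex n 0 (int i)) = Q ! i"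
  shows "field_of_tableaux n P Q = L"
  unfolding field_of_tableaux_def
proof (rule the_equality)
  fix L' assume L': "L' \<in> fomin_fields n (length (P ! 0)) \<and>
     (\<forall>i \<le> n. L' (vertex n (int i) 0) = P ! i \<and> L' (vertex n 0 (int i)) = Q ! i)"
  have "L' (vertex n i j) = L (vertex n i j)" for i j
  proof (rule plane_field_unique[OF n])
    show "plane_field n (length (P ! 0)) (\<lambda>i j. L' (vertex n i j))"
      "plane_field n (length (P ! 0)) (\<lambda>i j. L (vertex n i j))"
      using L L' unfolding fomin_fields_iff by blast+
  qed (use L' PQ in simp_all)
  then show "L' = L" using L L' fomin_fields_eqI by blast
qed (use L PQ in blast)

lemma Psi_eq:
  assumes n: "n \<ge> 1" and L: "L \<in> fomin_fields n l" and l: "length rho = l" "length (P ! 0) = l"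
    and PQ: "\<And>i. i \<le> n \<Longrightarrow> L (vertex n (int i) 0) = P ! i \<and> L (vertex n 0 (int i)) = Q ! i"
  shows "Psi n ((lam, rho), (P, Q)) = (environment n L, limit_signature l (\<lambda>t. L (vertex n t 0)))"
proof -
  have "field_of_tableaux n P Q = L" using field_of_tableaux_eq[OF n _ PQ] L l by simp
  then show ?thesis unfolding Psi_def using l by simp
qed

lemma field_of_SST:
  assumes n: "n \<ge> 1" and "rho \<in> signatures" and PQ: "P \<in> SST lam rho n" "Q \<in> SST lam rho n"
  shows "\<exists>L \<in> fomin_fields n (length rho).
    (\<forall>i \<le> n. L (vertex n (int i) 0) = P ! i \<and> L (vertex n 0 (int i)) = Q ! i)
    \<and> Psi n ((lam, rho), (P, Q)) = (environment n L, limit_signature (length rho) (\<lambda>t. L (vertex n t 0)))"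
proof -
  obtain K where K: "plane_field n (length rho) K" "\<forall>i \<le> n. K (int i) 0 = P ! i \<and> K 0 (int i) = Q ! i"
    using plane_field_exists[OF n tableau_pair_of_SST[OF assms(2) PQ]] by blast
  obtain L where L: "L \<in> fomin_fields n (length rho)" "\<And>i j. L (vertex n i j) = K i j"
    using fomin_fields_lift[OF K(1)] by blast
  have "length (P ! 0) = length rho" using PQ by (simp add: SST_def)
  from Psi_eq[OF n L(1) refl this] K(2) L show ?thesis by metis
qed

text \<open>Describes the inverse map on fields: the tableaux are read off along the two
  axes.\<close>

lemma SST_of_field:
  assumes n: "n \<ge> 1" and L: "L \<in> fomin_fields n l"
  defines "P \<equiv> map (\<lambda>i. L (vertex n (int i) 0)) [0..<n + 1]" and "Q \<equiv> map (\<lambda>i. L (vertex n 0 (int i))) [0..<n + 1]"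
    and "lam \<equiv> L (vertex n (int n) 0)" and "rho \<equiv> L (vertex n 0 0)"
  shows "lam \<in> signatures" "rho \<in> signatures" "P \<in> SST lam rho n" "Q \<in> SST lam rho n"
    "\<And>i. i \<le> n \<Longrightarrow> L (vertex n (int i) 0) = P ! i \<and> L (vertex n 0 (int i)) = Q ! i"
    "length rho = l" "length (P ! 0) = l"
proof -
  have pf: "plane_field n l (\<lambda>i j. L (vertex n i j))" using L by (simp add: fomin_fields_iff)
  have sig: "L (vertex n i j) \<in> signatures_of_length l" for i j using plane_field_signature[OF pf] .
  then have sig': "L (vertex n i j) \<in> signatures" for i j unfolding signatures_def by blast
  show "lam \<in> signatures" "rho \<in> signatures" "length rho = l"
    unfolding lam_def rho_def using sig' sig signature_length by blast+
  have nth: "P ! i = L (vertex n (int i) 0)" "Q ! i = L (vertex n 0 (int i))" if "i \<le> n" for i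
    unfolding P_def Q_def using that by (simp_all add: nth_map_upt del: upt_Suc)
  show "L (vertex n (int i) 0) = P ! i \<and> L (vertex n 0 (int i)) = Q ! i" if "i \<le> n" for i
    using nth[OF that] by simp
  show "length (P ! 0) = l" using nth sig signature_length by simp
  have il: "L (vertex n i j) \<preceq> L (vertex n (i + 1) j)" "L (vertex n i j) \<preceq> L (vertex n i (j + 1))" for i j
    using pf unfolding plane_field_iff by blast+
  have "P ! i \<preceq> P ! Suc i" "Q ! i \<preceq> Q ! Suc i" if "i < n" for i
    using that il(1)[of "int i" 0] il(2)[of 0 "int i"] by (simp_all add: nth add.commute)
  \<comment> \<open>This is why both tableaux end in the same shape.\<close>
  moreover have "vertex n 0 (int n) = vertex n (int n) 0" unfolding vertex_eq_iff by (auto intro!: exI[of _ 1])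
  ultimately show "P \<in> SST lam rho n" "Q \<in> SST lam rho n"
    unfolding SST_def using nth sig' by (auto simp: lam_def rho_def P_def Q_def simp del: upt_Suc)
qed

theorem proposition1p10:
  fixes n :: nat
  assumes "n \<ge> 1"
  shows "bij_betw (Psi n)
    (Sigma (signatures \<times> signatures) (\<lambda>(lam, rho). SST lam rho n \<times> SST lam rho n))
    (finsupp_functions (cylinder_faces n) \<times> signatures)"
  unfolding bij_betw_def
proof (intro conjI)
  let ?D = "Sigma (signatures \<times> signatures) (\<lambda>(lam, rho). SST lam rho n \<times> SST lam rho n)"
  let ?K = "\<lambda>L i j. L (vertex n i j)"
  have image: "(environment n L, limit_signature l (\<lambda>t. L (vertex n t 0)))
      \<in> finsupp_functions (cylinder_faces n) \<times> signatures" if L: "L \<in> fomin_fields n l" for L l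
  proof -
    have pf: "plane_field n l (?K L)" using L by (simp add: fomin_fields_iff)
    have "(\<lambda>i j. environment n L (face n i j)) = load (?K L) 0"
      using environment_eq(1)[OF assms L] by (simp add: fun_eq_iff)
    then have "environment n L \<in> finsupp_functions (cylinder_faces n)"
      unfolding finsupp_functions_iff[OF assms]
      using environment_eq(2)[OF assms L] field_load(2)[OF assms pf, of 0] by simp
    then show ?thesis using field_limit(1)[OF assms pf] by simp
  qed
  show "inj_on (Psi n) ?D"
  proof (rule inj_onI)
    fix a b assume a: "a \<in> ?D" and b: "b \<in> ?D" and eq: "Psi n a = Psi n b"
    obtain lam rho P Q where a': "a = ((lam, rho), (P, Q))" "rho \<in> signatures" "P \<in> SST lam rho n" "Q \<in> SST lam rho n"
      using a by auto
    obtain lam' rho' P' Q' where b': "b = ((lam', rho'), (P', Q'))" "rho' \<in> signatures" "P' \<in> SST lam' rho' n" "Q' \<in> SST lam' rho' n"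
      using b by auto
    obtain L where L: "L \<in> fomin_fields n (length rho)"
      "\<forall>i \<le> n. L (vertex n (int i) 0) = P ! i \<and> L (vertex n 0 (int i)) = Q ! i"
      "Psi n a = (environment n L, limit_signature (length rho) (\<lambda>t. L (vertex n t 0)))"
      using field_of_SST[OF assms a'(2-4)] unfolding a'(1) by blast
    obtain L' where L': "L' \<in> fomin_fields n (length rho')"
      "\<forall>i \<le> n. L' (vertex n (int i) 0) = P' ! i \<and> L' (vertex n 0 (int i)) = Q' ! i"
      "Psi n b = (environment n L', limit_signature (length rho') (\<lambda>t. L' (vertex n t 0)))"
      using field_of_SST[OF assms b'(2-4)] unfolding b'(1) by blast
    have "environment n L = environment n L'" using eq L(3) L'(3) by simp
    then have "load (?K L) 0 i j = load (?K L') 0 i j" for i j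
      using environment_eq(1)[OF assms L(1)] environment_eq(1)[OF assms L'(1)] by metis
    then have "load (?K L) 0 = load (?K L') 0" by (simp add: fun_eq_iff)
    moreover have "limit_signature (length rho) (\<lambda>t. L (vertex n t 0)) = limit_signature (length rho') (\<lambda>t. L' (vertex n t 0))"
      using eq L(3) L'(3) by simp
    ultimately have K: "?K L = ?K L'"
      using L(1) L'(1) by (intro field_determined[OF assms]) (auto simp: fomin_fields_iff)
    have "P ! i = P' ! i" "Q ! i = Q' ! i" if "i \<le> n" for i
      using L(2) L'(2) that K by (metis (mono_tags))+
    then have "P = P'" "Q = Q'" using a' b' by (auto simp: SST_def intro!: nth_equalityI)
    \<comment> \<open>The shapes are the first and last entries of the tableaux, so they agree as
      well.\<close>
    then show "a = b" using a' b' by (auto simp: SST_def)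
  qed
  show "Psi n ` ?D = finsupp_functions (cylinder_faces n) \<times> signatures"
  proof (intro equalityI subsetI)
    fix y assume "y \<in> Psi n ` ?D"
    then obtain lam rho P Q where "y = Psi n ((lam, rho), (P, Q))" "rho \<in> signatures"
        "P \<in> SST lam rho n" "Q \<in> SST lam rho n"
      by auto
    then obtain L where "L \<in> fomin_fields n (length rho)"
      "y = (environment n L, limit_signature (length rho) (\<lambda>t. L (vertex n t 0)))"
      using field_of_SST[OF assms] by metis
    then show "y \<in> finsupp_functions (cylinder_faces n) \<times> signatures" using image by blast
  next
    fix y assume "y \<in> finsupp_functions (cylinder_faces n) \<times> signatures"
    then obtain c nu where y: "y = (c, nu)" "c \<in> finsupp_functions (cylinder_faces n)" "nu \<in> signatures" by blast
    then have c: "\<And>F. F \<notin> cylinder_faces n \<Longrightarrow> c F = 0" "level_bounded (\<lambda>i j. c (face n i j))"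
      unfolding finsupp_functions_iff[OF assms] by blast+
    obtain l K where K: "plane_field n l K" "load K 0 = (\<lambda>i j. c (face n i j))"
      "limit_signature l (\<lambda>t. K t 0) = nu"
      using field_realizes[OF assms periodic_of_class(2) c(2) y(3)] by blast
    obtain L where L: "L \<in> fomin_fields n l" "\<And>i j. L (vertex n i j) = K i j"
      using fomin_fields_lift[OF K(1)] by blast
    have "?K L = K" using L(2) by (simp add: fun_eq_iff)
    then have face: "environment n L (face n i j) = c (face n i j)" for i j
      using environment_eq(1)[OF assms L(1), of i j] K(2) by simp
    have "environment n L = c"
    proof
      fix F show "environment n L F = c F"
        using face c(1) environment_eq(2)[OF assms L(1)]
        by (cases "F \<in> cylinder_faces n") (auto simp: cylinder_faces_eq)
    qed
    then have "y = (environment n L, limit_signature l (\<lambda>t. L (vertex n t 0)))" using y K(3) L(2) by simp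
    moreover note S = SST_of_field[OF assms L(1)]
    have "Psi n ((L (vertex n (int n) 0), L (vertex n 0 0)),
        (map (\<lambda>i. L (vertex n (int i) 0)) [0..<n + 1], map (\<lambda>i. L (vertex n 0 (int i))) [0..<n + 1]))
      = (environment n L, limit_signature l (\<lambda>t. L (vertex n t 0)))"
      by (rule Psi_eq[OF assms L(1) S(6,7,5)])
    ultimately have "y = Psi n ((L (vertex n (int n) 0), L (vertex n 0 0)),
        (map (\<lambda>i. L (vertex n (int i) 0)) [0..<n + 1], map (\<lambda>i. L (vertex n 0 (int i))) [0..<n + 1]))"
      by (simp only:)
    then show "y \<in> Psi n ` ?D" using S(1-4) by (intro image_eqI) auto
  qed
qed

end
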